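(* Let $r\geq 1$ be an integer. The pair of permutation statistics $(\mathsf{exc}_{r},\mathsf{den})$ is $r$-Euler--Mahonian; that is, for every positive integer $n$, $$\sum_{\sigma\in\mathfrak{S}_n} t^{\mathsf{exc}_r(\sigma)}q^{\mathsf{den}(\sigma)}=\sum_{\sigma\in\mathfrak{S}_n} t^{r\mathsf{des}(\sigma)}q^{r\mathsf{maj}(\sigma)}.$$
   Context: $\mathfrak{S}_n$ is the set of permutations of $[n]=\{1,\dots,n\}$, written in one-line notation $\sigma=\sigma_1\sigma_2\cdots\sigma_n$. For a word $u$ of distinct integers, $\mathsf{inv}(u)$ is the number of pairs of positions $i<j$ with $u_i>u_j$. A position $i$ is an excedance of $\sigma$ if $\sigma_i>i$; $\mathsf{Exc}(\sigma)$ is the set of excedances. $\mathsf{exc}_r(\sigma)=|\{i\in[n]:\sigma_i>i,\ i\geq r\}|$ (number of $r$-level excedances). Denert's statistic: let $\mathrm{EXCL}(\sigma)$ be the subsequence of $\sigma$ consisting of the letters $\sigma_i$ with $i\in\mathsf{Exc}(\sigma)$, and $\mathrm{NEXCL}(\sigma)$ the subsequence of the remaining letters; then $\mathsf{den}(\sigma)=\sum_{i\in\mathsf{Exc}(\sigma)} i+\mathsf{inv}(\mathrm{EXCL}(\sigma))+\mathsf{inv}(\mathrm{NEXCL}(\sigma))$. $r$-descents: $r\mathsf{Des}(\sigma)=\{i\in[n-1]:\sigma_i\geq\sigma_{i+1}+r\}$, $r\mathsf{des}(\sigma)=|r\mathsf{Des}(\sigma)|$. $r$-major index: $r\mathsf{maj}(\sigma)=\sum_{i\in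 r\mathsf{Des}(\sigma)} i+|\{(i,j):i<j,\ \sigma_i>\sigma_j,\ \sigma_i<\sigma_j+r\}|$. A pair of permutation statistics is called $r$-Euler--Mahonian if for every $n\geq1$ its joint distribution over $\mathfrak{S}_n$ equals that of $(r\mathsf{des},r\mathsf{maj})$. *)

theory Defs
  imports "HOL-Combinatorics.Permutations"
begin

text \<open>
  A permutation of \<open>[n]\<close> is a function \<open>\<sigma>\<close> with \<open>\<sigma> permutes {1..n}\<close>; its one-line notation
  is \<open>\<sigma> 1, \<dots>, \<sigma> n\<close>. A permutation statistic takes the size \<open>n\<close> as its first argument, since
  \<open>n\<close> cannot be read off from the underlying function \<open>nat \<Rightarrow> nat\<close>.
\<close>

definition perms :: "nat \<Rightarrow> (nat \<Rightarrow> nat) set" where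
  "perms n = {\<sigma>. \<sigma> permutes {1..n}}"

definition word_inv :: "nat list \<Rightarrow> nat" where
  "word_inv u = card {(i, j). i < j \<and> j < length u \<and> u ! i > u ! j}"

definition Exc :: "nat \<Rightarrow> (nat \<Rightarrow> nat) \<Rightarrow> nat set" where
  "Exc n \<sigma> = {i \<in> {1..n}. \<sigma> i > i}"

definition exc_level :: "nat \<Rightarrow> nat \<Rightarrow> (nat \<Rightarrow> nat) \<Rightarrow> nat" where
  "exc_level r n \<sigma> = card {i \<in> {1..n}. \<sigma> i > i \<and> i \<ge> r}"

definition EXCL :: "nat \<Rightarrow> (nat \<Rightarrow> nat) \<Rightarrow> nat list" where
  "EXCL n \<sigma> = map \<sigma> (filter (\<lambda>i. i \<in> Exc n \<sigma>) [1..<Suc n])"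

definition NEXCL :: "nat \<Rightarrow> (nat \<Rightarrow> nat) \<Rightarrow> nat list" where
  "NEXCL n \<sigma> = map \<sigma> (filter (\<lambda>i. i \<notin> Exc n \<sigma>) [1..<Suc n])"

definition den :: "nat \<Rightarrow> (nat \<Rightarrow> nat) \<Rightarrow> nat" where
  "den n \<sigma> = (\<Sum>i\<in>Exc n \<sigma>. i) + word_inv (EXCL n \<sigma>) + word_inv (NEXCL n \<sigma>)"

definition rDes :: "nat \<Rightarrow> nat \<Rightarrow> (nat \<Rightarrow> nat) \<Rightarrow> nat set" where
  "rDes r n \<sigma> = {i \<in> {1..<n}. \<sigma> i \<ge> \<sigma> (i + 1) + r}"

definition rdes :: "nat \<Rightarrow> nat \<Rightarrow> (nat \<Rightarrow> nat) \<Rightarrow> nat" where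
  "rdes r n \<sigma> = card (rDes r n \<sigma>)"

definition rmaj :: "nat \<Rightarrow> nat \<Rightarrow> (nat \<Rightarrow> nat) \<Rightarrow> nat" where
  "rmaj r n \<sigma> = (\<Sum>i\<in>rDes r n \<sigma>. i)
     + card {(i, j). i \<in> {1..n} \<and> j \<in> {1..n} \<and> i < j \<and> \<sigma> i > \<sigma> j \<and> \<sigma> i < \<sigma> j + r}"

definition r_Euler_Mahonian ::
  "nat \<Rightarrow> (nat \<Rightarrow> (nat \<Rightarrow> nat) \<Rightarrow> nat) \<Rightarrow> (nat \<Rightarrow> (nat \<Rightarrow> nat) \<Rightarrow> nat) \<Rightarrow> bool" where
  "r_Euler_Mahonian r st1 st2 \<longleftrightarrow>
     (\<forall>n\<ge>1. \<forall>a b. card {\<sigma> \<in> perms n. st1 n \<sigma> = a \<and> st2 n \<sigma> = b}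
                 = card {\<sigma> \<in> perms n. rdes r n \<sigma> = a \<and> rmaj r n \<sigma> = b})"

end

theory Submission imports Defs
begin

text \<open>Both pairs satisfy the same recursion. Passing from \<open>\<SS>\<^sub>m\<close> to \<open>\<SS>\<^sub>m\<^sub>+\<^sub>1\<close>, there are bijections
  \<open>\<SS>\<^sub>m \<times> {0, \<dots>, m} \<rightarrow> \<SS>\<^sub>m\<^sub>+\<^sub>1\<close> under which \<open>(s, c)\<close> with statistics \<open>(k, b)\<close> is sent to a permutation with
  statistics \<open>(k, b + c)\<close> if \<open>c < k + r\<close>, and \<open>(k + 1, b + c)\<close> otherwise. For \<open>(rdes, rmaj)\<close> it is insertion
  of the letter \<open>m + 1\<close> (Rawlings). For \<open>(exc\<^sub>r, den)\<close>, Han's insertion has the right effect on \<open>den\<close>, and on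
  \<open>exc\<^sub>r\<close> as long as the insertion position is at least \<open>r\<close>. For the remaining \<open>r - 1\<close> positions one first
  exchanges the label with the \<open>(r - 1)\<close>-st entry of Denert's code, which sums to \<open>den\<close>.\<close>

text \<open>Inserting at a position \<open>p < r\<close>, Han's map adds no position counted by
  \<open>exc_level r\<close>, but it carries position \<open>k = r - 1\<close> across the level; so
  growth is decided by \<open>s k > k\<close> and not by the label. Two coincidences repair this.
  The \<open>k\<close> positions below \<open>r\<close> carry \<open>k\<close> consecutive labels,
  and \<open>code s k\<close> also takes \<open>k\<close> values, so offset and code entry can trade
  places. And \<open>s k > k\<close> means \<open>code s k + cross s k \<ge> k\<close>, where
  \<open>cross s k\<close> depends only on letters after \<open>k\<close>, which the trade leaves
  alone. The condition thus becomes a lower bound on the original label, and this bound is exactly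
  \<open>exc_level r m s + r\<close>.\<close>

lemma permsD:
  assumes "s \<in> perms n"
  shows "inj s" "\<And>i. i \<in> {1..n} \<Longrightarrow> s i \<in> {1..n}" "\<And>i. i \<notin> {1..n} \<Longrightarrow> s i = i"
    "s ` {1..n} = {1..n}"
proof -
  have p: "s permutes {1..n}" using assms by (simp add: perms_def)
  show "inj s" using p by (rule permutes_inj)
  show "\<And>i. i \<in> {1..n} \<Longrightarrow> s i \<in> {1..n}" using permutes_in_image[OF p] by blast
  show "\<And>i. i \<notin> {1..n} \<Longrightarrow> s i = i" using permutes_not_in[OF p] by blast
  show "s ` {1..n} = {1..n}" using permutes_image[OF p] .
qed

lemma permsI:
  assumes "inj_on s {1..n}" "\<And>i. i \<in> {1..n} \<Longrightarrow> s i \<in> {1..n}" "\<And>i. i \<notin> {1..n} \<Longrightarrow> s i = i"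
  shows "s \<in> perms n"
proof -
  have "s ` {1..n} = {1..n}" by (rule endo_inj_surj) (use assms in auto)
  then have "bij_betw s {1..n} {1..n}" using assms(1) by (simp add: bij_betw_def)
  then show ?thesis unfolding perms_def using bij_imp_permutes assms(3) by blast
qed

lemma finite_perms [simp]: "finite (perms n)"
  unfolding perms_def by (rule finite_permutations) simp

lemma card_perms: "card (perms n) = fact n"
  unfolding perms_def by (rule card_permutations) auto

section \<open>Renumbering positions, and statistics as sums of indicators\<close>

definition skip :: "nat \<Rightarrow> nat \<Rightarrow> nat" where
  "skip p i = (if i < p then i else Suc i)"

lemma skip_less_iff [simp]: "skip p i < skip p j \<longleftrightarrow> i < j"
  by (auto simp: skip_def)

lemma less_skip_iff [simp]: "p < skip p i \<longleftrightarrow> p \<le> i"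
  by (auto simp: skip_def)

lemma skip_less_self_iff [simp]: "skip p i < p \<longleftrightarrow> i < p"
  by (auto simp: skip_def)

lemma skip_range:
  assumes "p \<in> {1..Suc m}"
  shows "{1..Suc m} = insert p (skip p ` {1..m})"
proof -
  have "i \<in> skip p ` {1..m}" if "i \<in> {1..Suc m}" "i \<noteq> p" for i
  proof (cases "i < p")
    case True
    then have "i = skip p i" "i \<in> {1..m}" using assms that by (auto simp: skip_def)
    then show ?thesis by blast
  next
    case False
    then have "i = skip p (i - 1)" "i - 1 \<in> {1..m}" using assms that by (auto simp: skip_def)
    then show ?thesis by blast
  qed
  moreover have "skip p ` {1..m} \<subseteq> {1..Suc m}" by (auto simp: skip_def)
  ultimately show ?thesis using assms by blast
qed

lemma sum_skip:
  fixes f :: "nat \<Rightarrow> 'a::comm_monoid_add"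
  assumes "p \<in> {1..Suc m}"
  shows "(\<Sum>i\<in>{1..Suc m}. f i) = f p + (\<Sum>i\<in>{1..m}. f (skip p i))"
proof -
  have "inj_on (skip p) {1..m}" by (rule inj_onI) (auto simp: skip_def split: if_splits)
  moreover have "p \<notin> skip p ` {1..m}" by (auto simp: skip_def)
  ultimately show ?thesis
    unfolding skip_range[OF assms] by (subst sum.insert) (auto simp: sum.reindex)
qed

lemma sum_sum_skip:
  fixes f :: "nat \<Rightarrow> nat \<Rightarrow> nat"
  assumes "p \<in> {1..Suc m}" "f p p = 0"
  shows "(\<Sum>j\<in>{1..Suc m}. \<Sum>i\<in>{1..Suc m}. f i j) = (\<Sum>j\<in>{1..m}. f p (skip p j))
    + (\<Sum>i\<in>{1..m}. f (skip p i) p) + (\<Sum>j\<in>{1..m}. \<Sum>i\<in>{1..m}. f (skip p i) (skip p j))"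
  unfolding sum_skip[OF assms(1)] sum.distrib using assms(2) by simp

lemma card_eq_sum: "card {i\<in>{1..n::nat}. P i} = (\<Sum>i\<in>{1..n}. of_bool (P i))"
  by (simp add: Int_def)

lemma card_pairs_eq_sum:
  "card {(i, j). i \<in> {1..n} \<and> j \<in> {1..n::nat} \<and> P i j} = (\<Sum>j\<in>{1..n}. \<Sum>i\<in>{1..n}. of_bool (P i j))"
proof -
  have "{(i, j). i \<in> {1..n} \<and> j \<in> {1..n} \<and> P i j} = (\<lambda>(j, i). (i, j)) ` (SIGMA j:{1..n}. {i\<in>{1..n}. P i j})"
    by auto
  moreover have "inj (\<lambda>(j::nat, i::nat). (i, j))" by (auto intro!: injI)
  ultimately have "card {(i, j). i \<in> {1..n} \<and> j \<in> {1..n} \<and> P i j} = card (SIGMA j:{1..n}. {i\<in>{1..n}. P i j})"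
    by (metis (lifting) card_image inj_on_subset top_greatest)
  also have "\<dots> = (\<Sum>j\<in>{1..n}. card {i\<in>{1..n}. P i j})" by simp
  finally show ?thesis unfolding card_eq_sum .
qed

lemma word_inv_snoc:
  "word_inv (u @ [x]) = word_inv u + length (filter (\<lambda>y. y > x) u)"
proof -
  have "{(i, j). i < j \<and> j < length (u @ [x]) \<and> (u @ [x]) ! i > (u @ [x]) ! j}
     = {(i, j). i < j \<and> j < length u \<and> u ! i > u ! j} \<union> (\<lambda>i. (i, length u)) ` {i. i < length u \<and> u ! i > x}"
    by (auto simp: nth_append less_Suc_eq split: if_splits)
  moreover have "finite {(i, j). i < j \<and> j < length u \<and> u ! i > u ! j}"
    by (rule finite_subset[of _ "{..<length u} \<times> {..<length u}"]) auto
  moreover have "card ((\<lambda>i. (i, length u)) ` {i. i < length u \<and> u ! i > x}) = length (filter (\<lambda>y. y > x) u)"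
    unfolding length_filter_conv_card by (rule card_image) (auto simp: inj_on_def)
  moreover have "{(i, j). i < j \<and> j < length u \<and> u ! i > u ! j} \<inter> (\<lambda>i. (i, length u)) ` {i. i < length u \<and> u ! i > x} = {}"
    by auto
  ultimately show ?thesis
    unfolding word_inv_def by (simp add: card_Un_disjoint)
qed

lemma word_inv_filter:
  "word_inv (map s (filter P [1..<Suc n]))
    = (\<Sum>j\<in>{1..n}. \<Sum>i\<in>{1..n}. of_bool (i < j \<and> P i \<and> P j \<and> s i > s j))"
proof (induction n)
  case 0
  then show ?case by (simp add: word_inv_def)
next
  case (Suc n)
  have len: "length (filter Q [1..<Suc n]) = (\<Sum>i\<in>{1..n}. of_bool (Q i))" for Q
    by (induction n) auto
  have "(\<Sum>j\<in>{1..Suc n}. \<Sum>i\<in>{1..Suc n}. of_bool (i < j \<and> P i \<and> P j \<and> s i > s j))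
    = (\<Sum>j\<in>{1..n}. \<Sum>i\<in>{1..n}. of_bool (i < j \<and> P i \<and> P j \<and> s i > s j))
      + (\<Sum>i\<in>{1..n}. of_bool (P i \<and> P (Suc n) \<and> s i > s (Suc n)) :: nat)"
    by (auto simp: sum.distrib simp del: sum_of_bool_eq intro!: arg_cong2[of _ _ _ _ plus] sum.cong)
  moreover have "word_inv (map s (filter P [1..<Suc (Suc n)])) = word_inv (map s (filter P [1..<Suc n]))
      + (\<Sum>i\<in>{1..n}. of_bool (P i \<and> P (Suc n) \<and> s i > s (Suc n)))"
    unfolding len[symmetric]
    by (cases "P (Suc n)") (simp_all add: word_inv_snoc filter_map filter_filter comp_def conj_commute)
  ultimately show ?case using Suc by simp
qed

lemma den_eq_sums:
  "den n s = (\<Sum>i\<in>{1..n}. of_bool (i < s i) * i)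
     + (\<Sum>j\<in>{1..n}. \<Sum>i\<in>{1..n}. of_bool (i < j \<and> i < s i \<and> j < s j \<and> s j < s i))
     + (\<Sum>j\<in>{1..n}. \<Sum>i\<in>{1..n}. of_bool (i < j \<and> s i \<le> i \<and> s j \<le> j \<and> s j < s i))"
proof -
  have "(\<Sum>i\<in>Exc n s. i) = (\<Sum>i\<in>{1..n}. of_bool (i < s i) * i)"
    unfolding Exc_def by (subst sum.inter_filter, simp, intro sum.cong refl, auto)
  moreover have "word_inv (EXCL n s)
    = (\<Sum>j\<in>{1..n}. \<Sum>i\<in>{1..n}. of_bool (i < j \<and> i < s i \<and> j < s j \<and> s j < s i))"
    unfolding EXCL_def word_inv_filter by (intro sum.cong refl) (auto simp: Exc_def)
  moreover have "word_inv (NEXCL n s)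
    = (\<Sum>j\<in>{1..n}. \<Sum>i\<in>{1..n}. of_bool (i < j \<and> s i \<le> i \<and> s j \<le> j \<and> s j < s i))"
    unfolding NEXCL_def word_inv_filter by (intro sum.cong refl) (auto simp: Exc_def)
  ultimately show ?thesis by (simp add: den_def)
qed

section \<open>Labels of insertion positions\<close>

text \<open>Positions in \<open>T\<close> and the last one, \<open>m + 1\<close>, are labelled \<open>0, \<dots>, |T|\<close> from right to left, the remaining
  ones \<open>|T| + 1, \<dots>, m\<close> from left to right.\<close>

definition lab :: "nat \<Rightarrow> nat set \<Rightarrow> nat \<Rightarrow> nat" where
  "lab m T p = (if p \<in> insert (Suc m) T then card {w\<in>T. p \<le> w} else p + card {w\<in>T. p \<le> w})"

text \<open>For \<open>p\<close> outside \<open>insert (Suc m) T\<close> at most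
  \<open>p - 1\<close> elements of \<open>T\<close> lie below \<open>p\<close>, so \<open>p\<close>
  plus the number of those beyond it exceeds \<open>card T\<close>.\<close>

lemma lab_le_card_iff:
  assumes "T \<subseteq> {1..m}" "p \<in> {1..Suc m}"
  shows "lab m T p \<le> card T \<longleftrightarrow> p \<in> insert (Suc m) T"
proof (cases "p \<in> insert (Suc m) T")
  case True
  have fin: "finite T" using assms(1) finite_subset by blast
  then show ?thesis using True by (auto simp: lab_def intro!: card_mono)
next
  case False
  have fin: "finite T" using assms(1) finite_subset by blast
  have "card {w\<in>T. w < p} \<le> card {1..<p}" by (rule card_mono) (use assms in auto)
  moreover have "card T = card {w\<in>T. w < p} + card {w\<in>T. p \<le> w}"
    by (subst card_Un_disjoint[symmetric]) (auto simp: fin intro!: arg_cong[of _ _ card])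
  ultimately show ?thesis using False assms(2) by (auto simp: lab_def)
qed

text \<open>Among positions of the same kind the label is strictly monotone: it drops when
  \<open>p\<close> in \<open>T\<close> is left behind, and otherwise \<open>p\<close> grows by more
  than the number of elements of \<open>T\<close> passed.\<close>

lemma bij_betw_lab:
  assumes T: "T \<subseteq> {1..m}"
  shows "bij_betw (lab m T) {1..Suc m} {0..m}"
proof -
  have fin: "finite T" using T finite_subset by blast
  have split: "card {w\<in>T. p \<le> w} = card {w\<in>T. p \<le> w \<and> w < p'} + card {w\<in>T. p' \<le> w}" if "p \<le> p'" for p p'
    by (subst card_Un_disjoint[symmetric]) (use that in \<open>auto simp: fin intro!: arg_cong[of _ _ card]\<close>)
  have ne: "lab m T p \<noteq> lab m T p'" if "p \<in> {1..Suc m}" "p' \<in> {1..Suc m}" "p < p'" for p p'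
  proof (cases "p \<in> insert (Suc m) T \<longleftrightarrow> p' \<in> insert (Suc m) T")
    case False
    then show ?thesis using lab_le_card_iff[OF T that(1)] lab_le_card_iff[OF T that(2)] by metis
  next
    case True
    show ?thesis
    proof (cases "p \<in> T")
      case True
      then have "card {w\<in>T. p \<le> w \<and> w < p'} > 0" using that fin by (auto simp: card_gt_0_iff)
      then show ?thesis using split[of p p'] that True \<open>_ \<longleftrightarrow> _\<close> by (auto simp: lab_def)
    next
      case False
      have "card {w\<in>T. p \<le> w \<and> w < p'} \<le> card {p<..<p'}"
        by (rule card_mono) (use False in \<open>auto simp: order_le_less\<close>)
      then show ?thesis using split[of p p'] that False \<open>_ \<longleftrightarrow> _\<close> by (auto simp: lab_def)
    qed
  qed
  have inj: "inj_on (lab m T) {1..Suc m}"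
    by (rule inj_onI) (metis ne linorder_neqE_nat)
  have "lab m T p \<in> {0..m}" if p: "p \<in> {1..Suc m}" for p
  proof (cases "p \<in> insert (Suc m) T")
    case True
    have "card T \<le> m" using card_mono[OF _ T] by simp
    then show ?thesis using True lab_le_card_iff[OF T p] by simp
  next
    case False
    have "card {w\<in>T. p \<le> w} \<le> card {p<..m}"
      by (rule card_mono) (use False T in \<open>auto simp: order_le_less\<close>)
    then show ?thesis using False p by (auto simp: lab_def)
  qed
  then have "lab m T ` {1..Suc m} = {0..m}"
    by (intro card_subset_eq) (auto simp: card_image[OF inj, simplified])
  then show ?thesis using inj by (simp add: bij_betw_def)
qed

section \<open>Denert's code\<close>

text \<open>Denert's code: \<open>code s j\<close> counts the earlier letters in the cyclic interval from \<open>s j + 1\<close> to \<open>j\<close>.\<close>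

definition code :: "(nat \<Rightarrow> nat) \<Rightarrow> nat \<Rightarrow> nat" where
  "code s j = (if s j \<le> j then card {i\<in>{1..<j}. s j < s i \<and> s i \<le> j}
                else card {i\<in>{1..<j}. s i \<le> j \<or> s j < s i})"

text \<open>Counts the arcs from \<open>i\<close> to \<open>s i\<close> passing upwards over the gap
  between \<open>k\<close> and \<open>k + 1\<close>.\<close>

definition cross :: "(nat \<Rightarrow> nat) \<Rightarrow> nat \<Rightarrow> nat" where
  "cross s k = card {i\<in>{1..k}. k < s i}"

lemma card_filter_split:
  assumes "finite A"
  shows "card A = card {x\<in>A. P x} + card {x\<in>A. \<not> P x}"
proof -
  have "A = {x\<in>A. P x} \<union> {x\<in>A. \<not> P x}" "{x\<in>A. P x} \<inter> {x\<in>A. \<not> P x} = {}" by auto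
  then show ?thesis using assms card_Un_disjoint[of "{x\<in>A. P x}" "{x\<in>A. \<not> P x}"] by simp
qed

lemma card_le_add_cross: "k = card {i\<in>{1..k}. s i \<le> k} + cross s k"
  using card_filter_split[of "{1..k}" "\<lambda>i. s i \<le> k"] by (simp add: cross_def not_le)

lemma card_vals_le:
  assumes s: "s \<in> perms m" and "k \<le> m"
  shows "card {i\<in>{1..m}. s i \<le> k} = k"
proof -
  have "s ` {i\<in>{1..m}. s i \<le> k} = {1..k}"
  proof (intro equalityI subsetI)
    fix v assume v: "v \<in> {1..k}"
    then have "v \<in> s ` {1..m}" using assms permsD(4)[OF s] by auto
    then show "v \<in> s ` {i\<in>{1..m}. s i \<le> k}" using v by auto
  qed (use permsD(2)[OF s] in auto)
  then show ?thesis
    by (metis card_atLeastAtMost diff_Suc_1 card_image inj_on_subset permsD(1)[OF s] top_greatest)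
qed

text \<open>Both sides complete \<open>card {i\<in>{1..k}. s i \<le> k}\<close> to \<open>k\<close>,
  by letters and by positions. The left side sees only letters after position
  \<open>k\<close>.\<close>

lemma card_ge_vals_le:
  assumes s: "s \<in> perms m" and "k \<le> m"
  shows "card {i\<in>{Suc k..m}. s i \<le> k} = cross s k"
proof -
  have "card {i\<in>{1..m}. s i \<le> k} = card {i\<in>{1..k}. s i \<le> k} + card {i\<in>{Suc k..m}. s i \<le> k}"
    by (subst card_Un_disjoint[symmetric]) (use assms in \<open>auto intro!: arg_cong[of _ _ card]\<close>)
  moreover have "k = card {i\<in>{1..k}. s i \<le> k} + cross s k" by (rule card_le_add_cross)
  moreover have "card {i\<in>{1..m}. s i \<le> k} = k" by (rule card_vals_le[OF assms])
  ultimately show ?thesis by simp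
qed

lemma cross_Suc:
  assumes s: "s \<in> perms m" and "Suc k \<le> m"
  shows "cross s (Suc k) + of_bool (\<exists>i\<in>{1..k}. s i = Suc k) = cross s k + of_bool (Suc k < s (Suc k))"
proof -
  have fin: "finite {i\<in>{1..k}. Q i}" for Q by simp
  have "{i\<in>{1..Suc k}. Suc k < s i} = {i\<in>{1..k}. Suc k < s i} \<union> (if Suc k < s (Suc k) then {Suc k} else {})"
    by (auto simp: le_Suc_eq)
  then have 1: "cross s (Suc k) = card {i\<in>{1..k}. Suc k < s i} + of_bool (Suc k < s (Suc k))"
    unfolding cross_def by (simp add: card_insert_if)
  have "{i\<in>{1..k}. k < s i} = {i\<in>{1..k}. Suc k < s i} \<union> {i\<in>{1..k}. s i = Suc k}" by auto
  then have 2: "cross s k = card {i\<in>{1..k}. Suc k < s i} + card {i\<in>{1..k}. s i = Suc k}"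
    unfolding cross_def by (subst card_Un_disjoint[symmetric]) auto
  have "card {i\<in>{1..k}. s i = Suc k} = of_bool (\<exists>i\<in>{1..k}. s i = Suc k)"
  proof (cases "\<exists>i\<in>{1..k}. s i = Suc k")
    case True
    then obtain i where "i \<in> {1..k}" "s i = Suc k" by blast
    then have "{i\<in>{1..k}. s i = Suc k} = {i}" using injD[OF permsD(1)[OF s]] by auto
    then show ?thesis using True by simp
  next
    case False
    then have "{i\<in>{1..k}. s i = Suc k} = {}" by blast
    then show ?thesis using False by simp
  qed
  then show ?thesis using 1 2 by simp
qed

text \<open>The counts \<open>cross s e\<close> change by \<open>+1\<close> at an excedance position and by \<open>-1\<close> at an excedance
  letter, so the two sums differ by a telescoping sum of triangular numbers.\<close>

lemma sum_cross:
  assumes s: "s \<in> perms m" and "k \<le> m"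
  shows "2 * (\<Sum>e\<in>{1..k}. of_bool (e < s e) * cross s e)
    = 2 * (\<Sum>v\<in>{1..k}. of_bool (\<exists>i\<in>{1..<v}. s i = v) * cross s (v - 1)) + cross s k * (cross s k + 1)"
  using assms(2)
proof (induction k)
  case 0
  then show ?case by (simp add: cross_def)
next
  case (Suc k)
  note IH = Suc.IH[OF Suc_leD[OF Suc.prems]]
  have iv: "{1..<Suc k} = {1..k}" by auto
  let ?a = "Suc k < s (Suc k)" and ?b = "\<exists>i\<in>{1..k}. s i = Suc k"
  have rec: "cross s (Suc k) + of_bool ?b = cross s k + of_bool ?a"
    by (rule cross_Suc[OF s Suc.prems])
  have "2 * (of_bool ?a * cross s (Suc k)) + cross s k * (cross s k + 1)
    = 2 * (of_bool ?b * cross s k) + cross s (Suc k) * (cross s (Suc k) + 1)"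
    using rec by (cases ?a; cases ?b) (auto simp: algebra_simps dest!: sym[of "Suc _"])
  then show ?case using IH by (simp add: iv algebra_simps)
qed

text \<open>At an excedance \<open>j\<close> the entry is \<open>j - cross s j\<close> plus the
  inversions \<open>X j\<close>; elsewhere it is \<open>N j\<close> plus a surplus
  \<open>Y j\<close> from earlier excedance letters between \<open>s j + 1\<close> and
  \<open>j\<close>. Summed by excedance letters \<open>v\<close>, the surplus is the sum of
  \<open>cross s (v - 1)\<close>; by \<open>sum_cross\<close> it makes up for the loss, because
  \<open>cross s m = 0\<close>.\<close>

lemma den_eq_sum_code:
  assumes s: "s \<in> perms m"
  shows "den m s = (\<Sum>j\<in>{1..m}. code s j)"
proof -
  have inj: "s i = s j \<longleftrightarrow> i = j" for i j using permsD(1)[OF s] by (auto dest: injD)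
  have m: "s i \<le> m" if "i \<le> m" for i using permsD(2)[OF s, of i] permsD(3)[OF s, of i] that by force
  define X :: "nat \<Rightarrow> nat" where "X j = (\<Sum>i\<in>{1..m}. of_bool (i < j \<and> i < s i \<and> j < s j \<and> s j < s i))" for j
  define N :: "nat \<Rightarrow> nat" where "N j = (\<Sum>i\<in>{1..m}. of_bool (i < j \<and> s i \<le> i \<and> s j \<le> j \<and> s j < s i))" for j
  define Y :: "nat \<Rightarrow> nat" where "Y j = (\<Sum>i\<in>{1..m}. of_bool (i < s i \<and> s j < s i \<and> s i \<le> j))" for j
  have restr: "card {i\<in>{1..<j}. Q i} = (\<Sum>i\<in>{1..m}. of_bool (i < j \<and> Q i))" if "j \<in> {1..m}" for Q j
    unfolding card_eq_sum[symmetric] by (rule arg_cong[of _ _ card]) (use that in auto)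
  have code: "code s j + of_bool (j < s j) * cross s j = of_bool (j < s j) * j + X j + N j + Y j" if j: "j \<in> {1..m}" for j
  proof (cases "j < s j")
    case False
    have "code s j = (\<Sum>i\<in>{1..m}. of_bool (i < j \<and> s j < s i \<and> s i \<le> j))"
      unfolding code_def restr[OF j] using False by simp
    also have "\<dots> = N j + Y j"
      unfolding N_def Y_def sum.distrib[symmetric] using False by (intro sum.cong refl) auto
    finally show ?thesis using False by (simp add: X_def)
  next
    case True
    have "code s j = (\<Sum>i\<in>{1..m}. of_bool (i < j \<and> (s i \<le> j \<or> s j < s i)))"
      unfolding code_def restr[OF j] using True by simp
    also have "\<dots> = (\<Sum>i\<in>{1..m}. of_bool (i < j \<and> s i \<le> j)) + X j"
      unfolding X_def sum.distrib[symmetric] using True by (intro sum.cong refl) auto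
    finally have 1: "code s j = card {i\<in>{1..<j}. s i \<le> j} + X j" unfolding restr[OF j] .
    have "j = card {i\<in>{1..j}. s i \<le> j} + cross s j" by (rule card_le_add_cross)
    moreover have "{i\<in>{1..j}. s i \<le> j} = {i\<in>{1..<j}. s i \<le> j}" using True by (auto simp: le_less)
    ultimately have "j = card {i\<in>{1..<j}. s i \<le> j} + cross s j" by simp
    moreover have "N j = 0" "Y j = 0" using True by (auto simp: N_def Y_def)
    ultimately show ?thesis using 1 True by simp
  qed
  have "(\<Sum>j\<in>{1..m}. Y j) = (\<Sum>i\<in>{1..m}. of_bool (i < s i) * cross s (s i - 1))"
    unfolding Y_def
  proof (subst sum.swap, intro sum.cong refl)
    fix i assume i: "i \<in> {1..m}"
    show "(\<Sum>j\<in>{1..m}. of_bool (i < s i \<and> s j < s i \<and> s i \<le> j)) = of_bool (i < s i) * cross s (s i - 1)"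
    proof (cases "i < s i")
      case True
      have "{j\<in>{1..m}. s j < s i \<and> s i \<le> j} = {j\<in>{Suc (s i - 1)..m}. s j \<le> s i - 1}"
        using True by auto
      moreover have "s i - 1 \<le> m" using m[of i] i by auto
      ultimately have "card {j\<in>{1..m}. s j < s i \<and> s i \<le> j} = cross s (s i - 1)"
        using card_ge_vals_le[OF s] by simp
      then show ?thesis using True unfolding card_eq_sum by simp
    qed simp
  qed
  moreover have "(\<Sum>i\<in>{1..m}. of_bool (i < s i) * cross s (s i - 1)) = (\<Sum>v\<in>{1..m}. of_bool (\<exists>i\<in>{1..<v}. s i = v) * cross s (v - 1))"
  proof -
    have "(\<Sum>v\<in>s ` {1..m}. of_bool (\<exists>i\<in>{1..<v}. s i = v) * cross s (v - 1))
       = (\<Sum>j\<in>{1..m}. of_bool (\<exists>i\<in>{1..<s j}. s i = s j) * cross s (s j - 1))"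
      by (subst sum.reindex) (use permsD(1)[OF s] in \<open>auto intro: inj_on_subset\<close>)
    then show ?thesis unfolding permsD(4)[OF s] inj by (auto intro!: sum.cong)
  qed
  moreover have "cross s m = 0" using m by (auto simp: cross_def not_less)
  ultimately have "(\<Sum>j\<in>{1..m}. Y j) = (\<Sum>j\<in>{1..m}. of_bool (j < s j) * cross s j)"
    using sum_cross[OF s, of m] \<open>cross s m = 0\<close> by simp
  moreover have "(\<Sum>j\<in>{1..m}. code s j) + (\<Sum>j\<in>{1..m}. of_bool (j < s j) * cross s j)
     = (\<Sum>j\<in>{1..m}. of_bool (j < s j) * j) + (\<Sum>j\<in>{1..m}. X j) + (\<Sum>j\<in>{1..m}. N j) + (\<Sum>j\<in>{1..m}. Y j)"
    unfolding sum.distrib[symmetric] using code by (intro sum.cong refl) simp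
  ultimately show ?thesis unfolding den_eq_sums X_def N_def by linarith
qed

lemma code_less: "j \<ge> 1 \<Longrightarrow> code s j < j"
proof -
  assume j: "j \<ge> 1"
  have "card {i\<in>{1..<j}. Q i} < j" for Q
  proof -
    have "card {i\<in>{1..<j}. Q i} \<le> card {1..<j}" by (rule card_mono) auto
    then show ?thesis using j by simp
  qed
  then show "code s j < j" by (simp add: code_def)
qed

lemma code_eq_card_vals:
  assumes s: "s \<in> perms m"
  shows "code s j = card {w\<in>s ` {1..j}. if s j \<le> j then s j < w \<and> w \<le> j else w \<le> j \<or> s j < w}"
proof -
  define Q where "Q w \<longleftrightarrow> (if s j \<le> j then s j < w \<and> w \<le> j else w \<le> j \<or> s j < w)" for w
  have "{w\<in>s ` {1..j}. Q w} = s ` {i\<in>{1..<j}. Q (s i)}" by (auto simp: Q_def le_less)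
  moreover have "card (s ` {i\<in>{1..<j}. Q (s i)}) = card {i\<in>{1..<j}. Q (s i)}"
    by (rule card_image) (rule inj_on_subset[OF permsD(1)[OF s]], simp)
  ultimately show ?thesis unfolding Q_def code_def by simp
qed

text \<open>For fixed \<open>V = {s 1, \<dots>, s j}\<close>, the code entry at \<open>j\<close> is the rank of \<open>s j\<close> in \<open>V\<close> with respect to
  the cyclic order \<open>j, j - 1, \<dots>, 1, m, m - 1, \<dots>, j + 1\<close>; so the letters can be read off from the right.\<close>

lemma code_eq_imp_eq:
  assumes s: "s \<in> perms m" and t: "t \<in> perms m" and k: "1 \<le> k"
    and eq: "\<And>j. j \<in> {k..m} \<Longrightarrow> code s j = code t j" and j: "k \<le> j"
  shows "s j = t j"
  using j
proof (induction "m - j" arbitrary: j rule: less_induct)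
  case less
  show ?case
  proof (cases "j \<le> m")
    case False
    then show ?thesis using permsD(3)[OF s, of j] permsD(3)[OF t, of j] by simp
  next
    case True
    have after: "s i = t i" if "i \<in> {j<..m}" for i
      using less.hyps[of i] that less.prems by auto
    have "s ` {1..j} = {1..m} - s ` {j<..m}"
    proof -
      have "s ` ({1..m} - {j<..m}) = s ` {1..m} - s ` {j<..m}"
        by (rule image_set_diff[OF permsD(1)[OF s]])
      moreover have "{1..m} - {j<..m} = {1..j}" using True by auto
      ultimately show ?thesis unfolding permsD(4)[OF s] by simp
    qed
    moreover have "t ` {1..j} = {1..m} - t ` {j<..m}"
    proof -
      have "t ` ({1..m} - {j<..m}) = t ` {1..m} - t ` {j<..m}"
        by (rule image_set_diff[OF permsD(1)[OF t]])
      moreover have "{1..m} - {j<..m} = {1..j}" using True by auto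
      ultimately show ?thesis unfolding permsD(4)[OF t] by simp
    qed
    ultimately have V: "s ` {1..j} = t ` {1..j}" using after by (metis image_cong)
    \<comment> \<open>\<open>R v\<close> collects the letters preceding \<open>v\<close> in the
      cyclic order; these sets grow strictly along it, so their size identifies
      \<open>v\<close>.\<close>
    define R where "R v = {w\<in>s ` {1..j}. if v \<le> j then v < w \<and> w \<le> j else w \<le> j \<or> v < w}" for v
    have fin: "finite (R v)" for v unfolding R_def by simp
    have mono: "card (R v) < card (R w)" if "v \<in> R w" for v w
    proof (rule psubset_card_mono[OF fin])
      have "v \<notin> R v" by (auto simp: R_def)
      moreover have "R v \<subseteq> R w" using that by (auto simp: R_def split: if_splits)
      ultimately show "R v \<subset> R w" using that by blast
    qed
    have total: "v \<in> R w \<or> w \<in> R v" if "v \<in> s ` {1..j}" "w \<in> s ` {1..j}" "v \<noteq> w" for v w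
      unfolding R_def mem_Collect_eq using that by (simp split: if_splits) linarith
    have "card (R (s j)) = card (R (t j))"
      using eq[of j] less.prems True code_eq_card_vals[OF s, of j] code_eq_card_vals[OF t, of j] V
      by (simp add: R_def)
    moreover have "s j \<in> s ` {1..j}" "t j \<in> s ` {1..j}" using V k less.prems by auto
    ultimately show ?thesis using total mono by (metis less_irrefl)
  qed
qed

text \<open>Surjectivity by counting: the code is injective, and there are \<open>fact m\<close>
  permutations and \<open>fact m\<close> admissible sequences.\<close>

lemma ex_code:
  assumes "\<And>j. j \<in> {1..m} \<Longrightarrow> c j < j"
  shows "\<exists>s. s \<in> perms m \<and> (\<forall>j\<in>{1..m}. code s j = c j)"
proof -
  let ?C = "\<lambda>s. restrict (code s) {1..m}"
  let ?P = "Pi\<^sub>E {1..m} (\<lambda>j. {..<j})"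
  have inj: "inj_on ?C (perms m)"
  proof (rule inj_onI)
    fix s t assume s: "s \<in> perms m" and t: "t \<in> perms m" and eq: "?C s = ?C t"
    have eq': "code s j = code t j" if "j \<in> {1..m}" for j
      using fun_cong[OF eq, of j] that by simp
    show "s = t"
    proof
      fix j
      show "s j = t j"
      proof (cases "1 \<le> j")
        case True
        then show ?thesis using code_eq_imp_eq[OF s t, of 1 j] eq' by simp
      next
        case False
        then show ?thesis using permsD(3)[OF s, of j] permsD(3)[OF t, of j] by simp
      qed
    qed
  qed
  have "card ?P = fact m"
    by (subst card_PiE) (simp_all add: fact_prod)
  moreover have "?C ` perms m \<subseteq> ?P" by (auto simp: code_less)
  ultimately have "?C ` perms m = ?P"
    by (intro card_subset_eq) (simp_all only: card_image[OF inj] card_perms finite_PiE finite_atLeastAtMost finite_lessThan)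
  moreover have "restrict c {1..m} \<in> ?P" using assms by auto
  ultimately have "restrict c {1..m} \<in> ?C ` perms m" by simp
  then obtain s where s: "s \<in> perms m" "restrict c {1..m} = ?C s" by (rule imageE)
  have "code s j = c j" if "j \<in> {1..m}" for j using fun_cong[OF s(2), of j] that by simp
  then show ?thesis using s(1) by blast
qed

text \<open>Of the first \<open>j\<close> positions, \<open>j - cross s j\<close> carry letters at
  most \<open>j\<close>. At an excedance the code counts all of these; otherwise it counts only some
  of them and never \<open>j\<close> itself.\<close>

lemma exc_iff_code:
  assumes s: "s \<in> perms m" and j: "j \<in> {1..m}"
  shows "j < s j \<longleftrightarrow> j \<le> code s j + cross s j"
proof (cases "j < s j")
  case True
  have "{i\<in>{1..j}. s i \<le> j} = {i\<in>{1..<j}. s i \<le> j}" using True by (auto simp: le_less)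
  moreover have "card {i\<in>{1..<j}. s i \<le> j} \<le> card {i\<in>{1..<j}. s i \<le> j \<or> s j < s i}"
    by (rule card_mono) auto
  ultimately have "card {i\<in>{1..j}. s i \<le> j} \<le> code s j"
    using True by (simp add: code_def)
  then show ?thesis using True card_le_add_cross[of j s] by simp
next
  case False
  have "{i\<in>{1..j}. s i \<le> j} = insert j {i\<in>{1..<j}. s i \<le> j}" using False j by auto
  then have "card {i\<in>{1..j}. s i \<le> j} = Suc (card {i\<in>{1..<j}. s i \<le> j})" by simp
  moreover have "card {i\<in>{1..<j}. s j < s i \<and> s i \<le> j} \<le> card {i\<in>{1..<j}. s i \<le> j}"
    by (rule card_mono) auto
  then have "code s j \<le> card {i\<in>{1..<j}. s i \<le> j}"
    using False by (simp add: code_def)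
  ultimately show ?thesis using False card_le_add_cross[of j s] by simp
qed

section \<open>Changing a single code entry\<close>

text \<open>For \<open>c < k\<close> and \<open>k \<le> m\<close> the choice is unambiguous:
  existence is \<open>ex_code\<close>, uniqueness \<open>code_eq_imp_eq\<close>.\<close>

definition recode :: "nat \<Rightarrow> nat \<Rightarrow> nat \<Rightarrow> (nat \<Rightarrow> nat) \<Rightarrow> nat \<Rightarrow> nat" where
  "recode m k c s = (SOME s'. s' \<in> perms m \<and> (\<forall>j\<in>{1..m}. code s' j = (if j = k then c else code s j)))"

lemma recode:
  assumes "c < k"
  shows "recode m k c s \<in> perms m"
    and "j \<in> {1..m} \<Longrightarrow> code (recode m k c s) j = (if j = k then c else code s j)"
proof -
  have "\<exists>s'. s' \<in> perms m \<and> (\<forall>j\<in>{1..m}. code s' j = (if j = k then c else code s j))"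
    by (rule ex_code) (use code_less assms in auto)
  from someI_ex[OF this] show "recode m k c s \<in> perms m"
    "j \<in> {1..m} \<Longrightarrow> code (recode m k c s) j = (if j = k then c else code s j)"
    unfolding recode_def by auto
qed

lemma recode_agrees:
  assumes "s \<in> perms m" "c < k" "k < j"
  shows "recode m k c s j = s j"
  by (rule code_eq_imp_eq[of _ m _ "Suc k"]) (use assms recode in auto)

lemma cross_recode:
  assumes s: "s \<in> perms m" and "c < k" "k \<le> m"
  shows "cross (recode m k c s) k = cross s k"
  unfolding card_ge_vals_le[OF s assms(3), symmetric] card_ge_vals_le[OF recode(1)[OF assms(2)] assms(3), symmetric]
  by (rule arg_cong[of _ _ card]) (use recode_agrees[OF assms(1,2)] in auto)

lemma exc_level_recode:
  assumes s: "s \<in> perms m" and "c < k"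
  shows "exc_level (Suc k) m (recode m k c s) = exc_level (Suc k) m s"
  unfolding exc_level_def by (rule arg_cong[of _ _ card]) (use recode_agrees[OF assms] in auto)

lemma den_recode:
  assumes s: "s \<in> perms m" and "c < k" "k \<le> m"
  shows "den m (recode m k c s) + code s k = den m s + c"
proof -
  have k: "k \<in> {1..m}" using assms by auto
  have "sum (code (recode m k c s)) ({1..m} - {k}) = sum (code s) ({1..m} - {k})"
    by (rule sum.cong) (use recode(2)[OF assms(2)] in auto)
  then show ?thesis
    unfolding den_eq_sum_code[OF s] den_eq_sum_code[OF recode(1)[OF assms(2)]]
    using sum.remove[OF _ k, of "code s"] sum.remove[OF _ k, of "code (recode m k c s)"] recode(2)[OF assms(2) k] by simp
qed

lemma recode_recode:
  assumes s: "s \<in> perms m" and "c < k" "k \<le> m"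
  shows "recode m k (code s k) (recode m k c s) = s"
proof
  fix j
  have k: "code s k < k" using assms code_less by auto
  show "recode m k (code s k) (recode m k c s) j = s j"
  proof (cases "1 \<le> j")
    case True
    show ?thesis
      by (rule code_eq_imp_eq[of _ m _ 1]) (use True assms k recode in auto)
  next
    case False
    then show ?thesis using permsD(3)[OF s, of j] permsD(3)[OF recode(1)[OF k], of j m] by simp
  qed
qed

text \<open>\<open>above m k s\<close> is the number of excedance letters greater than \<open>k\<close>, split according to whether their
  position exceeds \<open>k\<close>; both summands are unaffected by a change of the code at \<open>k\<close>.\<close>

definition above :: "nat \<Rightarrow> nat \<Rightarrow> (nat \<Rightarrow> nat) \<Rightarrow> nat" where
  "above m k s = exc_level (Suc k) m s + cross s k"

text \<open>Labels \<open>c\<close> with \<open>above m k s < c \<le> above m k s + k\<close> are those for which \<open>han\<close> below inserts at a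
  position \<open>\<le> k\<close>. Whether this creates an excedance at a position \<open>> k\<close> depends on \<open>s k > k\<close>, not
  on \<open>c\<close>; exchanging \<open>c\<close> with the code at \<open>k\<close> makes it depend on \<open>c\<close>.\<close>

definition swap_code :: "nat \<Rightarrow> nat \<Rightarrow> (nat \<Rightarrow> nat) \<times> nat \<Rightarrow> (nat \<Rightarrow> nat) \<times> nat" where
  "swap_code m k = (\<lambda>(s, c). if above m k s < c \<and> c \<le> above m k s + k
     then (recode m k (c - Suc (above m k s)) s, Suc (above m k s) + code s k) else (s, c))"

lemma above_recode:
  assumes "s \<in> perms m" "c < k" "k \<le> m"
  shows "above m k (recode m k c s) = above m k s"
  using assms by (simp add: above_def cross_recode exc_level_recode)

text \<open>Of the \<open>m - k\<close> positions after \<open>k\<close>, \<open>cross s k\<close>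
  hold letters at most \<open>k\<close>, and the excedances are among the rest. This keeps exchanged
  labels at most \<open>m\<close>.\<close>

lemma above_le:
  assumes s: "s \<in> perms m" and "k \<le> m"
  shows "above m k s + k \<le> m"
proof -
  have "exc_level (Suc k) m s \<le> card {i\<in>{1..m}. Suc k \<le> i \<and> k < s i}"
    unfolding exc_level_def by (rule card_mono) auto
  moreover have "card {i\<in>{Suc k..m}. s i \<le> k} = cross s k" by (rule card_ge_vals_le[OF assms])
  moreover have "card {Suc k..m} = card {i\<in>{Suc k..m}. s i \<le> k} + card {i\<in>{Suc k..m}. \<not> s i \<le> k}"
    by (rule card_filter_split) simp
  moreover have "{i\<in>{1..m}. Suc k \<le> i \<and> k < s i} = {i\<in>{Suc k..m}. \<not> s i \<le> k}" by auto
  ultimately show ?thesis using assms(2) unfolding above_def by simp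
qed

text \<open>An involution: the offset of \<open>c\<close> and \<open>code s k\<close> both range
  below \<open>k\<close>, and \<open>above\<close> is invariant, so the image passes the same test
  and is traded back.\<close>

lemma bij_betw_swap_code:
  assumes k: "k \<le> m"
  shows "bij_betw (swap_code m k) (perms m \<times> {0..m}) (perms m \<times> {0..m})"
proof -
  have inv: "swap_code m k (swap_code m k (s, c)) = (s, c)" if s: "s \<in> perms m" for s c
  proof (cases "above m k s < c \<and> c \<le> above m k s + k")
    case True
    define d where "d = c - Suc (above m k s)"
    have d: "d < k" "c = Suc (above m k s) + d" using True by (auto simp: d_def)
    have "code s k < k" using d code_less by auto
    moreover have "code (recode m k d s) k = d" using recode(2)[OF d(1)] d(1) k by simp
    ultimately show ?thesis
      using s d k by (simp add: swap_code_def above_recode recode_recode)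
  qed (auto simp: swap_code_def)
  have "swap_code m k (s, c) \<in> perms m \<times> {0..m}" if "s \<in> perms m" "c \<le> m" for s c
  proof (cases "above m k s < c \<and> c \<le> above m k s + k")
    case True
    then have "1 \<le> k" "c - Suc (above m k s) < k" by auto
    then show ?thesis using True above_le[OF that(1) k] code_less[of k s] recode(1)
      by (auto simp: swap_code_def)
  qed (use that in \<open>auto simp: swap_code_def\<close>)
  then have "swap_code m k ` (perms m \<times> {0..m}) \<subseteq> perms m \<times> {0..m}" by fastforce
  then show ?thesis
    by (intro bij_betw_byWitness[where f' = "swap_code m k"]) (use inv in auto)
qed

section \<open>Inserting the largest letter\<close>

definition ins :: "nat \<Rightarrow> nat \<Rightarrow> (nat \<Rightarrow> nat) \<Rightarrow> nat \<Rightarrow> nat" where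
  "ins m p s i = (if i < p then s i else if i = p then Suc m else if i \<le> Suc m then s (i - 1) else i)"

lemma ins_skip: "i \<in> {1..m} \<Longrightarrow> ins m p s (skip p i) = s i"
  by (auto simp: ins_def skip_def)

lemma ins_same: "ins m p s p = Suc m"
  by (simp add: ins_def)

lemma ins_perms:
  assumes s: "s \<in> perms m" and p: "p \<in> {1..Suc m}"
  shows "ins m p s \<in> perms (Suc m)"
proof (rule permsI)
  have ran: "s i \<in> {1..m}" if "i \<in> {1..m}" for i using permsD(2)[OF s that] .
  show "inj_on (ins m p s) {1..Suc m}"
    unfolding skip_range[OF p]
    by (rule inj_onI) (use ran in \<open>fastforce simp: ins_skip ins_same dest: injD[OF permsD(1)[OF s]]\<close>)
  fix i
  show "ins m p s i \<in> {1..Suc m}" if "i \<in> {1..Suc m}"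
  proof (cases "i = p")
    case False
    then obtain j where "i = skip p j" "j \<in> {1..m}" using \<open>i \<in> _\<close> unfolding skip_range[OF p] by blast
    then show ?thesis using ran[of j] by (simp add: ins_skip)
  qed (simp add: ins_same)
  show "ins m p s i = i" if "i \<notin> {1..Suc m}"
    using that p permsD(3)[OF s, of i] by (auto simp: ins_def)
qed

text \<open>Injectivity suffices, since \<open>fact m * Suc m = fact (Suc m)\<close>. Stated for an
  arbitrary \<open>G\<close> to serve both insertions.\<close>

lemma bij_betw_insertion:
  assumes lab: "\<And>s. s \<in> perms m \<Longrightarrow> bij_betw (L s) {1..Suc m} {0..m}"
    and G: "\<And>s p. s \<in> perms m \<Longrightarrow> p \<in> {1..Suc m} \<Longrightarrow> G p s \<in> perms (Suc m)"
    and inj: "\<And>s p s' p'. s \<in> perms m \<Longrightarrow> s' \<in> perms m \<Longrightarrow> p \<in> {1..Suc m} \<Longrightarrow> p' \<in> {1..Suc m} \<Longrightarrow>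
      G p s = G p' s' \<Longrightarrow> p = p' \<and> s = s'"
  shows "bij_betw (\<lambda>(s, c). G (the_inv_into {1..Suc m} (L s) c) s) (perms m \<times> {0..m}) (perms (Suc m))"
proof -
  have p: "the_inv_into {1..Suc m} (L s) c \<in> {1..Suc m}" "L s (the_inv_into {1..Suc m} (L s) c) = c"
    if "s \<in> perms m" "c \<in> {0..m}" for s c
    using bij_betwE[OF bij_betw_the_inv_into[OF lab[OF that(1)]]] f_the_inv_into_f_bij_betw[OF lab[OF that(1)]] that(2)
    by blast+
  have inj: "inj_on (\<lambda>(s, c). G (the_inv_into {1..Suc m} (L s) c) s) (perms m \<times> {0..m})"
  proof (rule inj_onI, clarify)
    fix s c s' c'
    assume 1: "s \<in> perms m" "c \<in> {0..m}" "s' \<in> perms m" "c' \<in> {0..m}"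
      and "G (the_inv_into {1..Suc m} (L s) c) s = G (the_inv_into {1..Suc m} (L s') c') s'"
    then have "the_inv_into {1..Suc m} (L s) c = the_inv_into {1..Suc m} (L s') c' \<and> s = s'"
      using inj p by blast
    then show "s = s' \<and> c = c'" using p[OF 1(1,2)] p[OF 1(3,4)] by metis
  qed
  moreover have "(\<lambda>(s, c). G (the_inv_into {1..Suc m} (L s) c) s) ` (perms m \<times> {0..m}) = perms (Suc m)"
  proof (rule card_subset_eq)
    show "(\<lambda>(s, c). G (the_inv_into {1..Suc m} (L s) c) s) ` (perms m \<times> {0..m}) \<subseteq> perms (Suc m)"
      using G p by auto
    show "card ((\<lambda>(s, c). G (the_inv_into {1..Suc m} (L s) c) s) ` (perms m \<times> {0..m})) = card (perms (Suc m))"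
      unfolding card_image[OF inj] by (simp add: card_cartesian_product card_perms)
  qed simp
  ultimately show ?thesis by (simp add: bij_betw_def)
qed

section \<open>Effect of the insertion on \<open>rdes\<close> and \<open>rmaj\<close>\<close>

text \<open>Besides \<open>m + 1\<close>, the positions where the largest letter adds no
  \<open>r\<close>-descent: after an \<open>r\<close>-descent, which merely moves, or before a
  letter too large to complete one.\<close>

definition des_labels :: "nat \<Rightarrow> nat \<Rightarrow> (nat \<Rightarrow> nat) \<Rightarrow> nat set" where
  "des_labels r m s = Suc ` rDes r m s \<union> {j\<in>{1..m}. Suc m < s j + r}"

lemma des_labels_subset: "des_labels r m s \<subseteq> {1..m}"
  by (auto simp: des_labels_def rDes_def)

lemma card_des_labels_ge:
  assumes s: "s \<in> perms m"
  shows "card {w\<in>des_labels r m s. p \<le> w} = card {i\<in>rDes r m s. p \<le> Suc i} + card {j\<in>{1..m}. p \<le> j \<and> Suc m < s j + r}"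
proof -
  have fin: "finite (rDes r m s)" by (simp add: rDes_def)
  have "{w\<in>des_labels r m s. p \<le> w} = Suc ` {i\<in>rDes r m s. p \<le> Suc i} \<union> {j\<in>{1..m}. p \<le> j \<and> Suc m < s j + r}"
    by (auto simp: des_labels_def)
  moreover have "Suc ` {i\<in>rDes r m s. p \<le> Suc i} \<inter> {j\<in>{1..m}. p \<le> j \<and> Suc m < s j + r} = {}"
    using permsD(2)[OF s] by (force simp: rDes_def)
  ultimately show ?thesis using fin by (simp add: card_Un_disjoint card_image)
qed

lemma card_des_labels:
  assumes s: "s \<in> perms m" and r: "1 \<le> r"
  shows "card (des_labels r m s) = rdes r m s + min (r - 1) m"
proof -
  have "card {j\<in>{1..m}. Suc m < s j + r} = card (s ` {j\<in>{1..m}. Suc m < s j + r})"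
    by (rule card_image[symmetric]) (rule inj_on_subset[OF permsD(1)[OF s]], simp)
  also have "s ` {j\<in>{1..m}. Suc m < s j + r} = {v\<in>s ` {1..m}. Suc m < v + r}" by auto
  \<comment> \<open>The letters above \<open>m + 1 - r\<close> are the \<open>r - 1\<close> largest,
    or all \<open>m\<close> of them if \<open>r > m\<close>; hence the minimum.\<close>
  also have "\<dots> = {Suc (m - min (r - 1) m)..m}" unfolding permsD(4)[OF s] using r by auto
  finally show ?thesis using card_des_labels_ge[OF s, of r 0] by (simp add: rdes_def)
qed

lemma lab_des_labels_le_iff:
  assumes s: "s \<in> perms m" and "1 \<le> r" "p \<in> {1..Suc m}"
  shows "p \<in> insert (Suc m) (des_labels r m s) \<longleftrightarrow> lab m (des_labels r m s) p < rdes r m s + r"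
proof -
  have "lab m (des_labels r m s) p \<le> m"
    using bij_betwE[OF bij_betw_lab[OF des_labels_subset]] assms(3) by fastforce
  then show ?thesis
    using lab_le_card_iff[OF des_labels_subset assms(3), of r s] card_des_labels[OF assms(1,2)] assms(2) by auto
qed

text \<open>Inserting the largest letter at position \<open>p\<close> destroys the descent at \<open>p - 1\<close>, if any, and
  creates one at \<open>p\<close> unless the letter following it is too large.\<close>

lemma sum_rDes_ins:
  fixes f :: "nat \<Rightarrow> nat"
  assumes s: "s \<in> perms m" and p: "p \<in> {1..Suc m}"
  shows "(\<Sum>i\<in>rDes r (Suc m) (ins m p s). f i) + of_bool (p - 1 \<in> rDes r m s) * f (p - 1)
    = (\<Sum>i\<in>rDes r m s. if p \<le> i then f (Suc i) else f i) + of_bool (p \<le> m \<and> s p + r \<le> Suc m) * f p"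
proof -
  let ?D = "rDes r m s" and ?D' = "rDes r (Suc m) (ins m p s)"
  have fin: "finite ?D" by (simp add: rDes_def)
  have le: "s i \<le> m" if "i \<le> m" for i using permsD(2)[OF s, of i] permsD(3)[OF s, of i] that by force
  \<comment> \<open>At \<open>p - 1\<close> the larger letter \<open>m + 1\<close> follows, so no
    descent survives there; for \<open>p = 1\<close> this index is \<open>0\<close>, which is never
    in \<open>rDes\<close>.\<close>
  have mem: "i \<in> ?D' \<longleftrightarrow> (i < p - 1 \<and> i \<in> ?D) \<or> (p < i \<and> i - 1 \<in> ?D) \<or> (i = p \<and> p \<le> m \<and> s p + r \<le> Suc m)" for i
  proof -
    consider "i < p - 1" | "i = p - 1" "i < p" | "i = p" | "p < i" by linarith
    then show ?thesis
    proof cases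
      case 2
      then show ?thesis using p le[of i] by (auto simp: rDes_def ins_def)
    next
      case 4
      then show ?thesis using p by (auto simp: rDes_def ins_def)
    qed (use p in \<open>auto simp: rDes_def ins_def\<close>)
  qed
  have D': "?D' = {i\<in>?D. i < p - 1} \<union> (Suc ` {i\<in>?D. p \<le> i} \<union> (if p \<le> m \<and> s p + r \<le> Suc m then {p} else {}))"
  proof (rule set_eqI)
    fix i
    have "i \<in> Suc ` {i\<in>?D. p \<le> i} \<longleftrightarrow> p < i \<and> i - 1 \<in> ?D"
      by (cases i) auto
    then show "i \<in> ?D' \<longleftrightarrow> i \<in> {i\<in>?D. i < p - 1} \<union> (Suc ` {i\<in>?D. p \<le> i} \<union> (if p \<le> m \<and> s p + r \<le> Suc m then {p} else {}))"
      unfolding mem by auto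
  qed
  have 1: "sum f ?D' = (\<Sum>i\<in>{i\<in>?D. i < p - 1}. f i) + (\<Sum>i\<in>{i\<in>?D. p \<le> i}. f (Suc i)) + of_bool (p \<le> m \<and> s p + r \<le> Suc m) * f p"
    unfolding D' by (subst sum.union_disjoint; (subst sum.union_disjoint)?) (use fin in \<open>auto simp: sum.reindex\<close>)
  have "x \<in> ?D \<longleftrightarrow> x \<in> {i\<in>?D. i < p - 1} \<union> ({i\<in>?D. p \<le> i} \<union> (if p - 1 \<in> ?D then {p - 1} else {}))" for x
    using p by (cases "x = p - 1") auto
  then have "?D = {i\<in>?D. i < p - 1} \<union> ({i\<in>?D. p \<le> i} \<union> (if p - 1 \<in> ?D then {p - 1} else {}))"
    by blast
  then have "sum g ?D = sum g ({i\<in>?D. i < p - 1} \<union> ({i\<in>?D. p \<le> i} \<union> (if p - 1 \<in> ?D then {p - 1} else {})))" for g :: "nat \<Rightarrow> nat"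
    by (rule arg_cong)
  also have "\<dots> g = (\<Sum>i\<in>{i\<in>?D. i < p - 1}. g i) + (\<Sum>i\<in>{i\<in>?D. p \<le> i}. g i) + of_bool (p - 1 \<in> ?D) * g (p - 1)" for g :: "nat \<Rightarrow> nat"
    by (subst sum.union_disjoint; (subst sum.union_disjoint)?) (use fin p in auto)
  finally have 2: "sum g ?D = (\<Sum>i\<in>{i\<in>?D. i < p - 1}. g i) + (\<Sum>i\<in>{i\<in>?D. p \<le> i}. g i) + of_bool (p - 1 \<in> ?D) * g (p - 1)" for g :: "nat \<Rightarrow> nat" .
  have "(\<Sum>i\<in>{i\<in>?D. i < p - 1}. if p \<le> i then f (Suc i) else f i) = (\<Sum>i\<in>{i\<in>?D. i < p - 1}. f i)"
    "(\<Sum>i\<in>{i\<in>?D. p \<le> i}. if p \<le> i then f (Suc i) else f i) = (\<Sum>i\<in>{i\<in>?D. p \<le> i}. f (Suc i))"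
    by (auto intro!: sum.cong)
  then show ?thesis using p unfolding 1 2 by auto
qed

text \<open>An \<open>r\<close>-descent at \<open>p - 1\<close> gives
  \<open>s p + r \<le> s (p - 1) \<le> m\<close>, so the descent destroyed there is always replaced
  by one at \<open>p\<close>.\<close>

lemma in_des_labels_iff:
  assumes s: "s \<in> perms m" and p: "p \<in> {1..Suc m}"
  shows "p \<notin> insert (Suc m) (des_labels r m s) \<longleftrightarrow> p - 1 \<notin> rDes r m s \<and> p \<le> m \<and> s p + r \<le> Suc m"
    and "p - 1 \<in> rDes r m s \<Longrightarrow> p \<le> m \<and> s p + r \<le> Suc m"
proof -
  have le: "s i \<le> m" if "i \<le> m" for i using permsD(2)[OF s, of i] permsD(3)[OF s, of i] that by force
  have "p \<in> Suc ` rDes r m s \<longleftrightarrow> p - 1 \<in> rDes r m s" using p by (cases p) auto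
  then show "p \<notin> insert (Suc m) (des_labels r m s) \<longleftrightarrow> p - 1 \<notin> rDes r m s \<and> p \<le> m \<and> s p + r \<le> Suc m"
    using p by (auto simp: des_labels_def)
  assume "p - 1 \<in> rDes r m s"
  then show "p \<le> m \<and> s p + r \<le> Suc m" using le[of "p - 1"] p by (auto simp: rDes_def)
qed

lemma rdes_ins:
  assumes s: "s \<in> perms m" and p: "p \<in> {1..Suc m}"
  shows "rdes r (Suc m) (ins m p s) = rdes r m s + of_bool (p \<notin> insert (Suc m) (des_labels r m s))"
  using sum_rDes_ins[OF assms, where r = r and f = "\<lambda>_. 1"] in_des_labels_iff[OF assms, of r]
  by (cases "p - 1 \<in> rDes r m s") (auto simp: rdes_def)

text \<open>Descents from \<open>p\<close> on are pushed right by one and a descent at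
  \<open>p - 1\<close> moves to \<open>p\<close>, which accounts for the condition
  \<open>p \<le> Suc i\<close>; a descent without such a predecessor adds \<open>p\<close>. The new
  small inversions pair \<open>m + 1\<close> with later letters above \<open>m + 1 - r\<close>.
  Together these counts form \<open>lab\<close>.\<close>

lemma rmaj_ins:
  assumes s: "s \<in> perms m" and p: "p \<in> {1..Suc m}"
  shows "rmaj r (Suc m) (ins m p s) = rmaj r m s + lab m (des_labels r m s) p"
proof -
  let ?D = "rDes r m s" and ?t = "ins m p s"
  have fin: "finite ?D" by (simp add: rDes_def)
  have le: "s i \<le> m" if "i \<in> {1..m}" for i using permsD(2)[OF s that] by simp
  have inv: "card {(i, j). i \<in> {1..Suc m} \<and> j \<in> {1..Suc m} \<and> i < j \<and> ?t i > ?t j \<and> ?t i < ?t j + r}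
    = card {j\<in>{1..m}. p \<le> j \<and> Suc m < s j + r}
      + card {(i, j). i \<in> {1..m} \<and> j \<in> {1..m} \<and> i < j \<and> s i > s j \<and> s i < s j + r}"
    unfolding card_pairs_eq_sum
  proof (subst sum_sum_skip[OF p])
    have "(\<Sum>j\<in>{1..m}. of_bool (p < skip p j \<and> ?t (skip p j) < ?t p \<and> ?t p < ?t (skip p j) + r))
      = card {j\<in>{1..m}. p \<le> j \<and> Suc m < s j + r}"
      unfolding card_eq_sum by (intro sum.cong refl) (use le in \<open>auto simp: ins_skip ins_same less_Suc_eq_le\<close>)
    moreover have "(\<Sum>i\<in>{1..m}. of_bool (skip p i < p \<and> ?t p < ?t (skip p i) \<and> ?t (skip p i) < ?t p + r)) = (0::nat)"
      by (intro sum.neutral) (use le in \<open>fastforce simp: ins_skip ins_same\<close>)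
    moreover have "(\<Sum>j\<in>{1..m}. \<Sum>i\<in>{1..m}. of_bool (skip p i < skip p j \<and> ?t (skip p j) < ?t (skip p i) \<and> ?t (skip p i) < ?t (skip p j) + r))
      = (\<Sum>j\<in>{1..m}. \<Sum>i\<in>{1..m}. of_bool (i < j \<and> s j < s i \<and> s i < s j + r) :: nat)"
      by (intro sum.cong refl) (simp add: ins_skip)
    ultimately show "(\<Sum>j\<in>{1..m}. of_bool (p < skip p j \<and> ?t (skip p j) < ?t p \<and> ?t p < ?t (skip p j) + r))
      + (\<Sum>i\<in>{1..m}. of_bool (skip p i < p \<and> ?t p < ?t (skip p i) \<and> ?t (skip p i) < ?t p + r))
      + (\<Sum>j\<in>{1..m}. \<Sum>i\<in>{1..m}. of_bool (skip p i < skip p j \<and> ?t (skip p j) < ?t (skip p i) \<and> ?t (skip p i) < ?t (skip p j) + r))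
      = card {j\<in>{1..m}. p \<le> j \<and> Suc m < s j + r}
        + (\<Sum>j\<in>{1..m}. \<Sum>i\<in>{1..m}. of_bool (i < j \<and> s j < s i \<and> s i < s j + r))" by presburger
  qed simp
  have "(\<Sum>i\<in>?D. if p \<le> i then Suc i else i) = (\<Sum>i\<in>?D. i) + (\<Sum>i\<in>?D. of_bool (p \<le> i))"
    unfolding sum.distrib[symmetric] by (intro sum.cong) auto
  also have "(\<Sum>i\<in>?D. of_bool (p \<le> i)) = card {i\<in>?D. p \<le> i}"
    using fin by (simp add: Int_def)
  finally have 1: "\<Sum> (rDes r (Suc m) ?t) + of_bool (p - 1 \<in> ?D) * (p - 1)
    = \<Sum> ?D + card {i\<in>?D. p \<le> i} + of_bool (p \<le> m \<and> s p + r \<le> Suc m) * p"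
    using sum_rDes_ins[OF assms, where r = r and f = "\<lambda>i. i"] by simp
  have "x \<in> {i\<in>?D. p \<le> Suc i} \<longleftrightarrow> x \<in> {i\<in>?D. p \<le> i} \<union> (if p - 1 \<in> ?D then {p - 1} else {})" for x
    using p by (cases "x = p - 1") auto
  then have "{i\<in>?D. p \<le> Suc i} = {i\<in>?D. p \<le> i} \<union> (if p - 1 \<in> ?D then {p - 1} else {})"
    by blast
  then have 2: "card {i\<in>?D. p \<le> Suc i} = card {i\<in>?D. p \<le> i} + of_bool (p - 1 \<in> ?D)"
    using fin p by (auto simp: card_insert_if)
  show ?thesis
    using 1 2 inv in_des_labels_iff[OF assms, of r] card_des_labels_ge[OF s, of r p] p
    unfolding rmaj_def lab_def by (cases "p - 1 \<in> ?D"; cases "p \<le> m \<and> s p + r \<le> Suc m") auto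
qed

definition des_ins :: "nat \<Rightarrow> nat \<Rightarrow> (nat \<Rightarrow> nat) \<times> nat \<Rightarrow> nat \<Rightarrow> nat" where
  "des_ins r m = (\<lambda>(s, c). ins m (the_inv_into {1..Suc m} (lab m (des_labels r m s)) c) s)"

lemma ins_eq_imp:
  assumes s: "s \<in> perms m" "s' \<in> perms m" and p: "p \<in> {1..Suc m}" "p' \<in> {1..Suc m}"
    and eq: "ins m p s = ins m p' s'"
  shows "p = p' \<and> s = s'"
proof -
  have "inj (ins m p' s')" by (rule permsD(1)[OF ins_perms[OF s(2) p(2)]])
  moreover have "ins m p' s' p = ins m p' s' p'" using eq ins_same by metis
  ultimately have "p = p'" by (auto dest: injD)
  moreover have "s i = s' i" for i
  proof (cases "i \<in> {1..m}")
    case True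
    then show ?thesis using eq \<open>p = p'\<close> ins_skip by metis
  next
    case False
    then show ?thesis using permsD(3)[OF s(1) False] permsD(3)[OF s(2) False] by simp
  qed
  ultimately show ?thesis by blast
qed

lemma the_inv_lab:
  assumes "T \<subseteq> {1..m}" "c \<in> {0..m}"
  shows "the_inv_into {1..Suc m} (lab m T) c \<in> {1..Suc m}"
    and "lab m T (the_inv_into {1..Suc m} (lab m T) c) = c"
  using bij_betwE[OF bij_betw_the_inv_into[OF bij_betw_lab[OF assms(1)]]]
    f_the_inv_into_f_bij_betw[OF bij_betw_lab[OF assms(1)]] assms(2) by blast+

lemma des_ins:
  assumes "1 \<le> r"
  shows "bij_betw (des_ins r m) (perms m \<times> {0..m}) (perms (Suc m))"
    and "s \<in> perms m \<Longrightarrow> c \<in> {0..m} \<Longrightarrow> rdes r (Suc m) (des_ins r m (s, c)) = rdes r m s + of_bool (rdes r m s + r \<le> c)"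
    and "s \<in> perms m \<Longrightarrow> c \<in> {0..m} \<Longrightarrow> rmaj r (Suc m) (des_ins r m (s, c)) = rmaj r m s + c"
proof -
  show "bij_betw (des_ins r m) (perms m \<times> {0..m}) (perms (Suc m))"
    unfolding des_ins_def by (rule bij_betw_insertion) (use bij_betw_lab[OF des_labels_subset] ins_perms ins_eq_imp in blast)+
  assume s: "s \<in> perms m" and c: "c \<in> {0..m}"
  define p where "p = the_inv_into {1..Suc m} (lab m (des_labels r m s)) c"
  have p: "p \<in> {1..Suc m}" "lab m (des_labels r m s) p = c"
    unfolding p_def by (rule the_inv_lab[OF des_labels_subset c])+
  have ins: "des_ins r m (s, c) = ins m p s" by (simp only: des_ins_def p_def split)
  show "rdes r (Suc m) (des_ins r m (s, c)) = rdes r m s + of_bool (rdes r m s + r \<le> c)"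
    using rdes_ins[OF s p(1), of r] lab_des_labels_le_iff[OF s assms p(1)] p(2)
    by (simp add: ins not_less)
  show "rmaj r (Suc m) (des_ins r m (s, c)) = rmaj r m s + c"
    using rmaj_ins[OF s p(1), of r] p(2) by (simp add: ins)
qed

section \<open>Han's insertion\<close>

definition exc_letters :: "nat \<Rightarrow> (nat \<Rightarrow> nat) \<Rightarrow> nat set" where
  "exc_letters m s = s ` {i\<in>{1..m}. i < s i}"

text \<open>\<open>han m p s\<close> inserts at position \<open>p\<close> the smallest excedance letter \<open>\<ge> p\<close>, or \<open>m + 1\<close> if there is none,
  and replaces each excedance letter \<open>\<ge> p\<close> by the next larger one, the largest by \<open>m + 1\<close>.\<close>

definition nxt :: "nat \<Rightarrow> nat set \<Rightarrow> nat \<Rightarrow> nat" where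
  "nxt m E v = (LEAST w. v < w \<and> w \<in> insert (Suc m) E)"

definition up :: "nat \<Rightarrow> nat set \<Rightarrow> nat \<Rightarrow> nat \<Rightarrow> nat" where
  "up m E p v = (if v \<in> E \<and> p \<le> v then nxt m E v else v)"

definition han :: "nat \<Rightarrow> nat \<Rightarrow> (nat \<Rightarrow> nat) \<Rightarrow> nat \<Rightarrow> nat" where
  "han m p s i = (if i < p then up m (exc_letters m s) p (s i)
     else if i = p then nxt m (exc_letters m s) (p - 1)
     else if i \<le> Suc m then up m (exc_letters m s) p (s (i - 1)) else i)"

lemma nxt:
  assumes "v \<le> m"
  shows "v < nxt m E v" "nxt m E v \<in> insert (Suc m) E"
proof -
  have "v < Suc m \<and> Suc m \<in> insert (Suc m) E" using assms by simp
  then have "v < nxt m E v \<and> nxt m E v \<in> insert (Suc m) E" unfolding nxt_def by (rule LeastI)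
  then show "v < nxt m E v" "nxt m E v \<in> insert (Suc m) E" by auto
qed

lemma nxt_le: "v < w \<Longrightarrow> w \<in> insert (Suc m) E \<Longrightarrow> nxt m E v \<le> w"
  unfolding nxt_def by (rule Least_le) simp

lemma exc_letters_subset:
  assumes "s \<in> perms m"
  shows "exc_letters m s \<subseteq> {1..m}"
  using permsD(2)[OF assms] unfolding exc_letters_def by blast

lemma in_exc_letters_iff:
  assumes s: "s \<in> perms m"
  shows "s i \<in> exc_letters m s \<longleftrightarrow> i < s i"
proof
  assume "s i \<in> exc_letters m s"
  then obtain j where "s i = s j" "j < s j" unfolding exc_letters_def by blast
  then show "i < s i" using injD[OF permsD(1)[OF s]] by metis
next
  assume "i < s i"
  moreover from this have "i \<in> {1..m}" using permsD(3)[OF s, of i] by (metis less_irrefl)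
  ultimately show "s i \<in> exc_letters m s" unfolding exc_letters_def by blast
qed

text \<open>An excedance at a position \<ge> \<open>p\<close> has a letter \<ge> \<open>p\<close>,
  and a letter \<ge> \<open>p\<close> at a position below \<open>p\<close> is an excedance. With
  \<open>p = Suc k\<close> this is \<open>above m k s\<close>.\<close>

lemma card_exc_letters_ge:
  assumes s: "s \<in> perms m" and p: "p \<in> {1..Suc m}"
  shows "card {w\<in>exc_letters m s. p \<le> w} = exc_level p m s + cross s (p - 1)"
proof -
  have "{w\<in>exc_letters m s. p \<le> w} = s ` {i\<in>{1..m}. i < s i \<and> p \<le> s i}"
    by (auto simp: exc_letters_def)
  then have "card {w\<in>exc_letters m s. p \<le> w} = card {i\<in>{1..m}. i < s i \<and> p \<le> s i}"
    using card_image[OF inj_on_subset[OF permsD(1)[OF s] subset_UNIV]] by metis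
  also have "{i\<in>{1..m}. i < s i \<and> p \<le> s i} = {i\<in>{1..m}. i < s i \<and> p \<le> i} \<union> {i\<in>{1..p - 1}. p - 1 < s i}"
    using p by auto
  also have "card \<dots> = exc_level p m s + cross s (p - 1)"
    unfolding exc_level_def cross_def by (subst card_Un_disjoint) auto
  finally show ?thesis .
qed

lemma finite_exc_letters: "finite (exc_letters m s)"
  by (simp add: exc_letters_def)

context
  fixes m p :: nat and s :: "nat \<Rightarrow> nat"
  assumes s: "s \<in> perms m" and p: "p \<in> {1..Suc m}"
begin

private abbreviation "E \<equiv> exc_letters m s"
private abbreviation "f \<equiv> nxt m E (p - 1)"
private abbreviation "u \<equiv> up m E p"
private abbreviation "t \<equiv> han m p s"

private lemma s_range: "i \<in> {1..m} \<Longrightarrow> s i \<in> {1..m}"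
  by (rule permsD(2)[OF s])

private lemma p_le_f: "p \<le> f" and f_mem: "f \<in> insert (Suc m) E"
proof -
  have "p - 1 \<le> m" using p by auto
  from nxt[OF this, of E] show "p \<le> f" "f \<in> insert (Suc m) E" by linarith+
qed

private lemma f_le: "w \<in> insert (Suc m) E \<Longrightarrow> p \<le> w \<Longrightarrow> f \<le> w"
  by (rule nxt_le) (use p in auto)

private lemma p_less_f_iff: "p < f \<longleftrightarrow> p \<notin> insert (Suc m) E"
  using p_le_f f_mem f_le[of p] by (metis leD le_refl order_le_less)

private lemma E_le: "v \<in> E \<Longrightarrow> v \<le> m"
  using exc_letters_subset[OF s] by auto

private lemma up_less:
  assumes "v \<in> E" "w \<in> E" "v < w"
  shows "u v < u w"
  using nxt_le[of v w m E] nxt(1)[of w m E] E_le assms by (auto simp: up_def)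

private lemma up_less_iff: "v \<in> E \<Longrightarrow> w \<in> E \<Longrightarrow> u v < u w \<longleftrightarrow> v < w"
  using up_less by (metis less_asym' linorder_neqE_nat)

private lemma up_mem: "v \<in> E \<Longrightarrow> u v \<in> insert (Suc m) E"
  using nxt(2)[of v m E] E_le[of v] by (auto simp: up_def)

private lemma up_nonexc: "v \<notin> E \<Longrightarrow> u v = v"
  by (simp add: up_def)

private lemma up_ge: "v \<le> u v"
  using nxt(1)[of v m E] E_le[of v] by (auto simp: up_def intro: less_imp_le)

lemma up_inj:
  assumes "v \<in> {1..m}" "w \<in> {1..m}" "u v = u w"
  shows "v = w"
proof -
  have "v = w" if "v \<in> {1..m}" "w \<in> {1..m}" "u v = u w" "v \<in> E" "w \<notin> E" for v w
    using that up_mem[of v] up_nonexc[of w] by auto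
  then show ?thesis using assms up_less_iff up_nonexc by (metis less_irrefl linorder_neqE_nat)
qed

private lemma f_less_up_iff: "v \<in> E \<Longrightarrow> f < u v \<longleftrightarrow> p \<le> v"
  and up_less_f_iff: "v \<in> E \<Longrightarrow> u v < f \<longleftrightarrow> v < p"
  using f_le[of v] nxt(1)[of v m E] E_le[of v] p_le_f by (auto simp: up_def)

private lemma up_neq_f:
  assumes v: "v \<in> {1..m}"
  shows "u v \<noteq> f"
proof (cases "v \<in> E")
  case True
  then show ?thesis using f_less_up_iff up_less_f_iff by (metis less_irrefl not_less)
next
  case False
  then show ?thesis using up_nonexc[OF False] f_mem v by auto
qed

lemma han_skip: "i \<in> {1..m} \<Longrightarrow> t (skip p i) = u (s i)"
  by (auto simp: han_def skip_def)

private lemma han_self: "t p = f"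
  by (simp add: han_def)

lemma han_perms: "t \<in> perms (Suc m)"
proof (rule permsI)
  show "inj_on t {1..Suc m}"
    unfolding skip_range[OF p]
  proof (rule inj_onI)
    fix x y
    assume x: "x \<in> insert p (skip p ` {1..m})" and y: "y \<in> insert p (skip p ` {1..m})" and eq: "t x = t y"
    have 1: "s a = s b \<Longrightarrow> a = b" for a b using injD[OF permsD(1)[OF s]] .
    have 2: "u (s a) = u (s b) \<Longrightarrow> a = b" if "a \<in> {1..m}" "b \<in> {1..m}" for a b
      using up_inj[OF s_range[OF that(1)] s_range[OF that(2)]] 1 by blast
    have 3: "u (s a) \<noteq> f" if "a \<in> {1..m}" for a by (rule up_neq_f[OF s_range[OF that]])
    show "x = y"
      using x y eq 2 3 by (elim insertE imageE) (simp_all add: han_skip han_self, metis+)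
  qed
  fix i
  show "t i \<in> {1..Suc m}" if i: "i \<in> {1..Suc m}"
  proof (cases "i = p")
    case True
    then show ?thesis using han_self f_mem E_le p_le_f p by fastforce
  next
    case False
    then obtain j where j: "i = skip p j" "j \<in> {1..m}" using i unfolding skip_range[OF p] by blast
    have "1 \<le> u (s j)" using s_range[OF j(2)] up_ge[of "s j"] by auto
    moreover have "u (s j) \<le> Suc m"
      using up_mem[of "s j"] up_nonexc[of "s j"] s_range[OF j(2)] E_le by fastforce
    ultimately show ?thesis using j by (simp add: han_skip)
  qed
  show "t i = i" if "i \<notin> {1..Suc m}"
  proof (cases "i = 0")
    case True
    then have "s i = 0" using permsD(3)[OF s, of i] by simp
    moreover have "0 \<notin> E" using exc_letters_subset[OF s] by auto
    ultimately show ?thesis using True p by (simp add: han_def up_def)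
  next
    case False
    then show ?thesis using that p by (auto simp: han_def)
  qed
qed

text \<open>An excedance at \<open>i \<ge> p\<close> has \<open>s i > p\<close>, so its letter rises
  along with its position. A nonexcedance keeps its letter while its position never drops.\<close>

private lemma exc_han_skip_iff:
  assumes i: "i \<in> {1..m}"
  shows "skip p i < t (skip p i) \<longleftrightarrow> i < s i"
proof (cases "i < s i")
  case True
  then have "s i \<in> E" by (simp add: in_exc_letters_iff[OF s])
  then have "i < u (s i)" "p \<le> i \<Longrightarrow> Suc i < u (s i)"
    using True up_ge[of "s i"] nxt(1)[of "s i" m E] E_le[of "s i"] by (auto simp: up_def)
  then show ?thesis unfolding han_skip[OF i] using True by (auto simp: skip_def)
next
  case False
  then have "u (s i) \<le> i" by (simp add: in_exc_letters_iff[OF s] up_nonexc)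
  then show ?thesis unfolding han_skip[OF i] using False by (auto simp: skip_def)
qed

text \<open>Excedances from \<open>p\<close> on move one place, adding
  \<open>exc_level p m s\<close>. If \<open>f > p\<close>, the new excedance adds \<open>p\<close>
  and has \<open>cross s (p - 1)\<close> larger excedance letters on its left; if
  \<open>f = p\<close>, the new nonexcedance has as many smaller nonexcedance letters on its right.
  By \<open>card_exc_letters_ge\<close> either sum is the label.\<close>

lemma den_han: "den (Suc m) t = den m s + lab m E p"
proof -
  have ex: "skip p i < u (s i) \<longleftrightarrow> i < s i" "u (s i) \<le> skip p i \<longleftrightarrow> s i \<le> i" if "i \<in> {1..m}" for i
    using exc_han_skip_iff[OF that] unfolding han_skip[OF that] by auto
  have E: "s i \<in> E \<longleftrightarrow> i < s i" for i by (rule in_exc_letters_iff[OF s])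
  have S1: "(\<Sum>i\<in>{1..Suc m}. of_bool (i < t i) * i)
    = of_bool (p < f) * p + (\<Sum>i\<in>{1..m}. of_bool (i < s i) * i) + exc_level p m s"
  proof -
    have "(\<Sum>i\<in>{1..m}. of_bool (skip p i < t (skip p i)) * skip p i)
      = (\<Sum>i\<in>{1..m}. of_bool (i < s i) * i + of_bool (i < s i \<and> p \<le> i))"
      by (intro sum.cong refl) (simp only: exc_han_skip_iff, auto simp: skip_def)
    then show ?thesis
      unfolding sum_skip[OF p] exc_level_def card_eq_sum sum.distrib by (simp add: han_self del: sum_of_bool_eq)
  qed
  have S2: "(\<Sum>j\<in>{1..Suc m}. \<Sum>i\<in>{1..Suc m}. of_bool (i < j \<and> i < t i \<and> j < t j \<and> t j < t i))
    = (\<Sum>j\<in>{1..m}. \<Sum>i\<in>{1..m}. of_bool (i < j \<and> i < s i \<and> j < s j \<and> s j < s i)) + of_bool (p < f) * cross s (p - 1)"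
  proof (subst sum_sum_skip[OF p])
    have "(\<Sum>j\<in>{1..m}. of_bool (p < skip p j \<and> p < t p \<and> skip p j < t (skip p j) \<and> t (skip p j) < t p)) = (0::nat)"
    proof (intro sum.neutral ballI)
      fix j assume j: "j \<in> {1..m}"
      have "\<not> u (s j) < f" if "p \<le> j" "j < s j"
        using up_less_f_iff[of "s j"] that E by auto
      then show "of_bool (p < skip p j \<and> p < t p \<and> skip p j < t (skip p j) \<and> t (skip p j) < t p) = (0::nat)"
        unfolding han_skip[OF j] ex(1)[OF j] han_self by auto
    qed
    moreover have "(\<Sum>i\<in>{1..m}. of_bool (skip p i < p \<and> skip p i < t (skip p i) \<and> p < t p \<and> t p < t (skip p i))) = of_bool (p < f) * cross s (p - 1)"
    proof -
      have "(\<Sum>i\<in>{1..m}. of_bool (skip p i < p \<and> skip p i < t (skip p i) \<and> p < t p \<and> t p < t (skip p i)))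
        = (\<Sum>i\<in>{1..m}. of_bool (p < f \<and> i \<le> p - 1 \<and> p - 1 < s i))"
      proof (intro sum.cong refl arg_cong[of _ _ of_bool])
        fix i assume i: "i \<in> {1..m}"
        show "(skip p i < p \<and> skip p i < t (skip p i) \<and> p < t p \<and> t p < t (skip p i)) = (p < f \<and> i \<le> p - 1 \<and> p - 1 < s i)"
          unfolding ex(1)[OF i] han_skip[OF i] han_self using f_less_up_iff[of "s i"] E[of i] p by auto
      qed
      also have "\<dots> = of_bool (p < f) * card {i\<in>{1..m}. i \<le> p - 1 \<and> p - 1 < s i}"
        unfolding card_eq_sum by (cases "p < f") auto
      also have "{i\<in>{1..m}. i \<le> p - 1 \<and> p - 1 < s i} = {i\<in>{1..p - 1}. p - 1 < s i}" using p by auto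
      finally show ?thesis unfolding cross_def .
    qed
    moreover have "(\<Sum>j\<in>{1..m}. \<Sum>i\<in>{1..m}. of_bool (skip p i < skip p j \<and> skip p i < t (skip p i) \<and> skip p j < t (skip p j) \<and> t (skip p j) < t (skip p i)))
      = (\<Sum>j\<in>{1..m}. \<Sum>i\<in>{1..m}. of_bool (i < j \<and> i < s i \<and> j < s j \<and> s j < s i) :: nat)"
    proof (intro sum.cong refl arg_cong[of _ _ of_bool])
      fix i j assume i: "i \<in> {1..m}" and j: "j \<in> {1..m}"
      show "(skip p i < skip p j \<and> skip p i < t (skip p i) \<and> skip p j < t (skip p j) \<and> t (skip p j) < t (skip p i))
        = (i < j \<and> i < s i \<and> j < s j \<and> s j < s i)"
        unfolding ex(1)[OF i] ex(1)[OF j] han_skip[OF i] han_skip[OF j] using up_less_iff E by auto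
    qed
    ultimately show "(\<Sum>j\<in>{1..m}. of_bool (p < skip p j \<and> p < t p \<and> skip p j < t (skip p j) \<and> t (skip p j) < t p))
      + (\<Sum>i\<in>{1..m}. of_bool (skip p i < p \<and> skip p i < t (skip p i) \<and> p < t p \<and> t p < t (skip p i)))
      + (\<Sum>j\<in>{1..m}. \<Sum>i\<in>{1..m}. of_bool (skip p i < skip p j \<and> skip p i < t (skip p i) \<and> skip p j < t (skip p j) \<and> t (skip p j) < t (skip p i)))
      = (\<Sum>j\<in>{1..m}. \<Sum>i\<in>{1..m}. of_bool (i < j \<and> i < s i \<and> j < s j \<and> s j < s i)) + of_bool (p < f) * cross s (p - 1)"
      by presburger
  qed simp
  have S3: "(\<Sum>j\<in>{1..Suc m}. \<Sum>i\<in>{1..Suc m}. of_bool (i < j \<and> t i \<le> i \<and> t j \<le> j \<and> t j < t i))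
    = (\<Sum>j\<in>{1..m}. \<Sum>i\<in>{1..m}. of_bool (i < j \<and> s i \<le> i \<and> s j \<le> j \<and> s j < s i)) + of_bool (f \<le> p) * cross s (p - 1)"
  proof (subst sum_sum_skip[OF p])
    have "(\<Sum>j\<in>{1..m}. of_bool (p < skip p j \<and> t p \<le> p \<and> t (skip p j) \<le> skip p j \<and> t (skip p j) < t p)) = of_bool (f \<le> p) * cross s (p - 1)"
    proof -
      have "(\<Sum>j\<in>{1..m}. of_bool (p < skip p j \<and> t p \<le> p \<and> t (skip p j) \<le> skip p j \<and> t (skip p j) < t p))
        = (\<Sum>j\<in>{1..m}. of_bool (f \<le> p \<and> p \<le> j \<and> s j \<le> p - 1))"
      proof (intro sum.cong refl arg_cong[of _ _ of_bool])
        fix j assume j: "j \<in> {1..m}"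
        show "(p < skip p j \<and> t p \<le> p \<and> t (skip p j) \<le> skip p j \<and> t (skip p j) < t p) = (f \<le> p \<and> p \<le> j \<and> s j \<le> p - 1)"
          unfolding ex(2)[OF j] han_skip[OF j] han_self using up_nonexc[of "s j"] E[of j] p p_le_f by auto
      qed
      also have "\<dots> = of_bool (f \<le> p) * card {j\<in>{1..m}. p \<le> j \<and> s j \<le> p - 1}"
        unfolding card_eq_sum by (cases "f \<le> p") auto
      also have "{j\<in>{1..m}. p \<le> j \<and> s j \<le> p - 1} = {j\<in>{Suc (p - 1)..m}. s j \<le> p - 1}" using p by auto
      also have "card \<dots> = cross s (p - 1)" by (rule card_ge_vals_le[OF s]) (use p in auto)
      finally show ?thesis .
    qed
    moreover have "(\<Sum>i\<in>{1..m}. of_bool (skip p i < p \<and> t (skip p i) \<le> skip p i \<and> t p \<le> p \<and> t p < t (skip p i))) = (0::nat)"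
    proof (intro sum.neutral ballI)
      fix i assume i: "i \<in> {1..m}"
      show "of_bool (skip p i < p \<and> t (skip p i) \<le> skip p i \<and> t p \<le> p \<and> t p < t (skip p i)) = (0::nat)"
        unfolding of_bool_eq_0_iff han_self using p_le_f by linarith
    qed
    moreover have "(\<Sum>j\<in>{1..m}. \<Sum>i\<in>{1..m}. of_bool (skip p i < skip p j \<and> t (skip p i) \<le> skip p i \<and> t (skip p j) \<le> skip p j \<and> t (skip p j) < t (skip p i)))
      = (\<Sum>j\<in>{1..m}. \<Sum>i\<in>{1..m}. of_bool (i < j \<and> s i \<le> i \<and> s j \<le> j \<and> s j < s i) :: nat)"
    proof (intro sum.cong refl arg_cong[of _ _ of_bool])
      fix i j assume i: "i \<in> {1..m}" and j: "j \<in> {1..m}"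
      show "(skip p i < skip p j \<and> t (skip p i) \<le> skip p i \<and> t (skip p j) \<le> skip p j \<and> t (skip p j) < t (skip p i))
        = (i < j \<and> s i \<le> i \<and> s j \<le> j \<and> s j < s i)"
        unfolding ex(2)[OF i] ex(2)[OF j] han_skip[OF i] han_skip[OF j] using up_nonexc[of "s i"] up_nonexc[of "s j"] E by auto
    qed
    ultimately show "(\<Sum>j\<in>{1..m}. of_bool (p < skip p j \<and> t p \<le> p \<and> t (skip p j) \<le> skip p j \<and> t (skip p j) < t p))
      + (\<Sum>i\<in>{1..m}. of_bool (skip p i < p \<and> t (skip p i) \<le> skip p i \<and> t p \<le> p \<and> t p < t (skip p i)))
      + (\<Sum>j\<in>{1..m}. \<Sum>i\<in>{1..m}. of_bool (skip p i < skip p j \<and> t (skip p i) \<le> skip p i \<and> t (skip p j) \<le> skip p j \<and> t (skip p j) < t (skip p i)))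
      = (\<Sum>j\<in>{1..m}. \<Sum>i\<in>{1..m}. of_bool (i < j \<and> s i \<le> i \<and> s j \<le> j \<and> s j < s i)) + of_bool (f \<le> p) * cross s (p - 1)"
      by presburger
  qed simp
  show ?thesis
    unfolding den_eq_sums S1 S2 S3 lab_def card_exc_letters_ge[OF s p] using p_less_f_iff
    by (cases "p < f") auto
qed

lemma exc_level_han:
  assumes "r \<le> p"
  shows "exc_level r (Suc m) t = exc_level r m s + of_bool (p \<notin> insert (Suc m) E)"
proof -
  have "(\<Sum>i\<in>{1..m}. of_bool (skip p i < t (skip p i) \<and> r \<le> skip p i)) = (\<Sum>i\<in>{1..m}. of_bool (i < s i \<and> r \<le> i) :: nat)"
  proof (intro sum.cong refl arg_cong[of _ _ of_bool])
    fix i assume i: "i \<in> {1..m}"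
    have "r \<le> skip p i \<longleftrightarrow> r \<le> i" using assms by (auto simp: skip_def)
    then show "(skip p i < t (skip p i) \<and> r \<le> skip p i) = (i < s i \<and> r \<le> i)"
      unfolding exc_han_skip_iff[OF i] by simp
  qed
  then show ?thesis
    unfolding exc_level_def card_eq_sum sum_skip[OF p] using p_less_f_iff assms by (simp add: han_self del: sum_of_bool_eq)
qed

text \<open>The new position is below the level \<open>Suc k\<close>, and \<open>k\<close> is the
  only old position carried across it.\<close>

lemma exc_level_han_small:
  assumes "p \<le> k" "k \<le> m"
  shows "exc_level (Suc k) (Suc m) t = exc_level (Suc k) m s + of_bool (k < s k)"
proof -
  have k: "k \<in> {1..m}" using assms p by auto
  have "(\<Sum>i\<in>{1..m}. of_bool (skip p i < t (skip p i) \<and> Suc k \<le> skip p i)) = (\<Sum>i\<in>{1..m}. of_bool (i < s i \<and> k \<le> i) :: nat)"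
  proof (intro sum.cong refl arg_cong[of _ _ of_bool])
    fix i assume i: "i \<in> {1..m}"
    have "Suc k \<le> skip p i \<longleftrightarrow> k \<le> i" using assms by (auto simp: skip_def)
    then show "(skip p i < t (skip p i) \<and> Suc k \<le> skip p i) = (i < s i \<and> k \<le> i)"
      unfolding exc_han_skip_iff[OF i] by simp
  qed
  then have "exc_level (Suc k) (Suc m) t = card {i\<in>{1..m}. i < s i \<and> k \<le> i}"
    unfolding exc_level_def card_eq_sum sum_skip[OF p] using assms by simp
  also have "{i\<in>{1..m}. i < s i \<and> k \<le> i} = {i\<in>{1..m}. i < s i \<and> Suc k \<le> i} \<union> (if k < s k then {k} else {})"
    using k by (auto simp: Suc_le_eq order_le_less)
  also have "card \<dots> = exc_level (Suc k) m s + of_bool (k < s k)"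
    unfolding exc_level_def by auto
  finally show ?thesis .
qed

text \<open>Each bound compares the number of excedance letters between \<open>p\<close> and
  \<open>k\<close> with the length of that interval; for \<open>p \<le> k\<close> outside
  \<open>E\<close> the interval lacks \<open>p\<close>, so the summand \<open>p\<close> in the label
  does not overshoot.\<close>

lemma lab_exc_letters:
  assumes "k \<le> m"
  shows "p \<le> k \<Longrightarrow> above m k s < lab m E p \<and> lab m E p \<le> above m k s + k"
    and "k < p \<Longrightarrow> p \<in> insert (Suc m) E \<Longrightarrow> lab m E p \<le> above m k s"
    and "k < p \<Longrightarrow> p \<notin> insert (Suc m) E \<Longrightarrow> above m k s + k < lab m E p"
proof -
  have ab: "above m k s = card {w\<in>E. Suc k \<le> w}"
    using card_exc_letters_ge[OF s, of "Suc k"] assms by (simp add: above_def)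
  have split: "card {w\<in>E. a \<le> w} = card {w\<in>E. a \<le> w \<and> w < b} + card {w\<in>E. b \<le> w}" if "a \<le> b" for a b
    by (subst card_Un_disjoint[symmetric]) (use that in \<open>auto simp: finite_exc_letters intro!: arg_cong[of _ _ card]\<close>)
  have le: "card {w\<in>E. a \<le> w \<and> w < b} \<le> b - a" for a b
    by (rule order_trans[OF card_mono[of "{a..<b}"]]) auto
  have le': "card {w\<in>E. a \<le> w \<and> w < b} \<le> b - Suc a" if "a \<notin> E" for a b
    by (rule order_trans[OF card_mono[of "{Suc a..<b}"]]) (use that in \<open>auto simp: Suc_le_eq order_le_less\<close>)
  show "above m k s < lab m E p \<and> lab m E p \<le> above m k s + k" if "p \<le> k"
  proof (cases "p \<in> E")
    case True
    then have "0 < card {w\<in>E. p \<le> w \<and> w < Suc k}" using that by (auto simp: card_gt_0_iff finite_exc_letters)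
    then show ?thesis using True that split[of p "Suc k"] le[of p "Suc k"] p unfolding ab lab_def by auto
  next
    case False
    then show ?thesis using that split[of p "Suc k"] le'[of p "Suc k"] p assms unfolding ab lab_def by auto
  qed
  show "lab m E p \<le> above m k s" if "k < p" "p \<in> insert (Suc m) E"
    using that split[of "Suc k" p] unfolding ab lab_def by simp
  show "above m k s + k < lab m E p" if "k < p" "p \<notin> insert (Suc m) E"
    using that split[of "Suc k" p] le[of "Suc k" p] unfolding ab lab_def by simp
qed

section \<open>Recovering \<open>p\<close> and \<open>s\<close> from the image under
  \<open>han\<close>\<close>

text \<open>With \<open>exc_letter_of_han\<close>: the excedance letters of \<open>t\<close> other
  than \<open>m + 1\<close> are those of \<open>s\<close>, save that \<open>p\<close> is lost when
  it becomes a fixed point.\<close>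

lemma exc_letter_han:
  assumes "w \<in> E" "w \<noteq> p"
  shows "\<exists>j. j < t j \<and> t j = w"
proof -
  have "w \<in> t ` {1..Suc m}" unfolding permsD(4)[OF han_perms] using exc_letters_subset[OF s] assms(1) by auto
  then obtain j where j: "j \<in> {1..Suc m}" "t j = w" by auto
  have "j < t j"
  proof (cases "j = p")
    case True
    then show ?thesis using j assms p_le_f han_self by auto
  next
    case False
    then obtain a where a: "j = skip p a" "a \<in> {1..m}" using j unfolding skip_range[OF p] by blast
    have "s a \<in> E" using a j assms up_nonexc han_skip by metis
    then show ?thesis using exc_han_skip_iff[OF a(2)] a(1) by (simp add: in_exc_letters_iff[OF s])
  qed
  then show ?thesis using j by blast
qed

lemma exc_letter_of_han:
  assumes "j < t j"
  shows "t j \<in> insert (Suc m) E" and "j \<noteq> p \<Longrightarrow> \<exists>v\<in>E. t j = u v"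
proof -
  have j: "j \<in> {1..Suc m}" using permsD(3)[OF han_perms, of j] assms by (metis less_irrefl)
  show 1: "\<exists>v\<in>E. t j = u v" if ne: "j \<noteq> p"
  proof -
    obtain a where a: "j = skip p a" "a \<in> {1..m}" using j ne unfolding skip_range[OF p] by blast
    then have "s a \<in> E" using assms exc_han_skip_iff[OF a(2)] by (simp add: in_exc_letters_iff[OF s])
    then show ?thesis using a han_skip by blast
  qed
  show "t j \<in> insert (Suc m) E"
  proof (cases "j = p")
    case True
    then show ?thesis using f_mem han_self by simp
  next
    case False
    then obtain v where "v \<in> E" "t j = u v" using 1 by blast
    then show ?thesis using up_mem[of v] by simp
  qed
qed

lemma han_fixed_iff: "t p = p \<longleftrightarrow> p \<in> insert (Suc m) E"
  unfolding han_self using p_less_f_iff p_le_f by (metis less_irrefl order_le_less)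

text \<open>The next two lemmas characterise \<open>p\<close> as the largest position \<open>i\<close> such that \<open>t i \<ge> i\<close> and no
  excedance letter of \<open>t\<close> lies in the interval from \<open>i\<close> to \<open>t i - 1\<close>.\<close>

lemma han_critical: "p \<le> t p" "j < t j \<Longrightarrow> p \<le> t j \<Longrightarrow> t p \<le> t j"
proof -
  show "p \<le> t p" using p_le_f han_self by simp
  assume j: "j < t j" "p \<le> t j"
  show "t p \<le> t j"
  proof (cases "j = p")
    case False
    then obtain v where v: "v \<in> E" "t j = u v" using exc_letter_of_han(2)[OF j(1)] by blast
    have "p \<le> v" using v j(2) up_def[of m E p v] by (auto split: if_splits)
    then show ?thesis using f_less_up_iff[OF v(1)] v han_self by simp
  qed simp
qed

lemma han_not_critical:
  assumes i: "p < i" "i \<in> {1..Suc m}" "i \<le> t i"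
  shows "\<exists>j. j < t j \<and> i \<le> t j \<and> t j < t i"
proof -
  obtain a where a: "i = skip p a" "a \<in> {1..m}" using i unfolding skip_range[OF p] by blast
  then have ai: "i = Suc a" "p \<le> a" using i(1) by (auto simp: skip_def split: if_splits)
  have ti: "t i = u (s a)" using a han_skip by simp
  have E: "s a \<in> E"
    using up_nonexc[of "s a"] i(3) ti ai in_exc_letters_iff[OF s, of a] by fastforce
  then have less: "a < s a" by (simp add: in_exc_letters_iff[OF s])
  \<comment> \<open>The witness is the old letter \<open>s a\<close>: it is still an excedance
    letter of \<open>t\<close>, and \<open>i \<le> s a < t i\<close> because \<open>up\<close>
    raised it.\<close>
  then obtain j where j: "j < t j" "t j = s a" using exc_letter_han[OF E] ai by auto
  moreover have "s a < u (s a)"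
    using less ai E nxt(1)[of "s a" m "exc_letters m s"] E_le[OF E] by (simp add: up_def)
  ultimately have "i \<le> t j \<and> t j < t i" using less ai ti by simp
  then show ?thesis using j(1) by blast
qed

end

text \<open>Maximality among critical positions gives \<open>p = p'\<close>. Then the excedance
  letters agree: \<open>p\<close> is one exactly when it is fixed by the image (or is
  \<open>m + 1\<close>), and the others persist. Finally \<open>up\<close> is injective.\<close>

lemma han_inj:
  assumes s: "s \<in> perms m" "s' \<in> perms m" and p: "p \<in> {1..Suc m}" "p' \<in> {1..Suc m}"
    and eq: "han m p s = han m p' s'"
  shows "p = p' \<and> s = s'"
proof -
  have "\<not> p < p'"
    using han_not_critical[OF s(1) p(1), of p'] han_critical[OF s(2) p(2)] p(2) unfolding eq by force
  moreover have "\<not> p' < p"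
    using han_not_critical[OF s(2) p(2), of p] han_critical[OF s(1) p(1)] p(1) unfolding eq by force
  ultimately have pp: "p = p'" by simp
  have sub: "exc_letters m s \<subseteq> exc_letters m s'"
    if s: "s \<in> perms m" "s' \<in> perms m" and eq: "han m p s = han m p s'" for s s'
  proof
    fix w assume w: "w \<in> exc_letters m s"
    have "w \<in> insert (Suc m) (exc_letters m s')"
    proof (cases "w = p")
      case True
      then show ?thesis using han_fixed_iff[OF s(1) p(1)] han_fixed_iff[OF s(2) p(1)] w eq by simp
    next
      case False
      then show ?thesis using exc_letter_han[OF s(1) p(1) w] exc_letter_of_han(1)[OF s(2) p(1)] eq by metis
    qed
    then show "w \<in> exc_letters m s'" using exc_letters_subset[OF s(1)] w by auto
  qed
  have "exc_letters m s = exc_letters m s'"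
    using sub[OF s] sub[OF s(2,1)] eq pp by auto
  note E = this
  have "s i = s' i" for i
  proof (cases "i \<in> {1..m}")
    case True
    have "han m p s (skip p i) = han m p s' (skip p i)" using eq pp by simp
    then have "up m (exc_letters m s) p (s i) = up m (exc_letters m s) p (s' i)"
      unfolding han_skip[OF s(1) p(1) True] han_skip[OF s(2) p(1) True] E .
    then show ?thesis using up_inj[OF s(1) p(1)] permsD(2)[OF s(1) True] permsD(2)[OF s(2) True] by blast
  next
    case False
    then show ?thesis using permsD(3)[OF s(1) False] permsD(3)[OF s(2) False] by simp
  qed
  then show ?thesis using pp by blast
qed

section \<open>Equidistribution\<close>

definition exc_ins :: "nat \<Rightarrow> nat \<Rightarrow> (nat \<Rightarrow> nat) \<times> nat \<Rightarrow> nat \<Rightarrow> nat" where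
  "exc_ins r m = (\<lambda>(s, c). han m (the_inv_into {1..Suc m} (lab m (exc_letters m s)) c) s)
    \<circ> (if r \<le> Suc m then swap_code m (r - 1) else id)"

lemma den_swap_code:
  assumes s: "s \<in> perms m" and k: "k \<le> m" and eq: "swap_code m k (s, c) = (s', c')"
  shows "den m s' + c' = den m s + c"
proof (cases "above m k s < c \<and> c \<le> above m k s + k")
  case True
  then have "c - Suc (above m k s) < k" by auto
  from den_recode[OF s this k] show ?thesis using True eq by (auto simp: swap_code_def)
qed (use eq in \<open>auto simp: swap_code_def\<close>)

lemma exc_ins:
  assumes r: "1 \<le> r"
  shows "bij_betw (exc_ins r m) (perms m \<times> {0..m}) (perms (Suc m))"
    and "s \<in> perms m \<Longrightarrow> c \<in> {0..m} \<Longrightarrow>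
      exc_level r (Suc m) (exc_ins r m (s, c)) = exc_level r m s + of_bool (exc_level r m s + r \<le> c)"
    and "s \<in> perms m \<Longrightarrow> c \<in> {0..m} \<Longrightarrow> den (Suc m) (exc_ins r m (s, c)) = den m s + c"
proof -
  let ?W = "if r \<le> Suc m then swap_code m (r - 1) else id"
  have W: "bij_betw ?W (perms m \<times> {0..m}) (perms m \<times> {0..m})"
    using bij_betw_swap_code[of "r - 1" m] by auto
  have "bij_betw (\<lambda>(s, c). han m (the_inv_into {1..Suc m} (lab m (exc_letters m s)) c) s)
    (perms m \<times> {0..m}) (perms (Suc m))"
    by (rule bij_betw_insertion) (use bij_betw_lab[OF exc_letters_subset] han_perms han_inj in blast)+
  with W show "bij_betw (exc_ins r m) (perms m \<times> {0..m}) (perms (Suc m))"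
    unfolding exc_ins_def by (rule bij_betw_trans)
  assume s: "s \<in> perms m" and c: "c \<in> {0..m}"
  obtain s' c' where sc': "?W (s, c) = (s', c')" by (meson surj_pair)
  have s': "s' \<in> perms m" and c': "c' \<in> {0..m}"
    using bij_betwE[OF W] s c sc' by (metis mem_Sigma_iff)+
  define p where "p = the_inv_into {1..Suc m} (lab m (exc_letters m s')) c'"
  have p: "p \<in> {1..Suc m}" "lab m (exc_letters m s') p = c'"
    unfolding p_def by (rule the_inv_lab[OF exc_letters_subset[OF s'] c'])+
  have ins: "exc_ins r m (s, c) = han m p s'"
    unfolding exc_ins_def comp_apply sc' p_def by simp
  show "den (Suc m) (exc_ins r m (s, c)) = den m s + c"
    unfolding ins den_han[OF s' p(1)] p(2) using den_swap_code[OF s, of "r - 1" c s' c'] sc' 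
    by (auto split: if_splits)
  show "exc_level r (Suc m) (exc_ins r m (s, c)) = exc_level r m s + of_bool (exc_level r m s + r \<le> c)"
  proof (cases "r \<le> Suc m")
    case False
    have "exc_level r n t = 0" if "t \<in> perms n" "n < r" for n t
      using that by (auto simp: exc_level_def)
    then show ?thesis using s c han_perms[OF s' p(1)] False unfolding ins by auto
  next
    case True
    define k where "k = r - 1"
    have k: "r = Suc k" "k \<le> m" using r True by (auto simp: k_def)
    have W': "swap_code m k (s, c) = (s', c')" using sc' True k by simp
    have cross_le: "cross s k \<le> k"
      unfolding cross_def by (rule order_trans[OF card_mono[of "{1..k}"]]) auto
    show ?thesis
    proof (cases "above m k s < c \<and> c \<le> above m k s + k")
      case mid: True
      define d where "d = c - Suc (above m k s)"
      have d: "d < k" "c = Suc (above m k s) + d" using mid by (auto simp: d_def)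
      have sc: "s' = recode m k d s" "c' = Suc (above m k s) + code s k"
        using W' mid by (auto simp: swap_code_def d_def)
      have km: "k \<in> {1..m}" using d k by auto
      have ab: "above m k s' = above m k s" unfolding sc by (rule above_recode[OF s d(1) k(2)])
      have "code s k < k" using code_less km by auto
      then have "above m k s' < c' \<and> c' \<le> above m k s' + k" using ab sc by simp
      then have "p \<le> k"
        using lab_exc_letters(2,3)[OF s' p(1) k(2)] p(2) by (meson leD leI)
      then have "exc_level r (Suc m) (han m p s') = exc_level r m s' + of_bool (k < s' k)"
        using exc_level_han_small[OF s' p(1) _ k(2)] k(1) by simp
      moreover have "exc_level r m s' = exc_level r m s"
        unfolding sc k(1) by (rule exc_level_recode[OF s d(1)])
      \<comment> \<open>The code of \<open>s'\<close> at \<open>k\<close> is the offset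
        \<open>d\<close> and \<open>cross\<close> is unchanged, so the excedance at \<open>k\<close>
        is now a condition on \<open>c = exc_level r m s + cross s k + 1 + d\<close>.\<close>
      moreover have "k < s' k \<longleftrightarrow> k \<le> d + cross s k"
        unfolding exc_iff_code[OF s' km] using recode(2)[OF d(1) km, of s] cross_recode[OF s d(1) k(2)] sc by simp
      moreover have "\<dots> \<longleftrightarrow> exc_level r m s + r \<le> c"
        using d k unfolding above_def by auto
      ultimately show ?thesis unfolding ins by simp
    next
      case out: False
      then have sc: "s' = s" "c' = c" using W' by (auto simp: swap_code_def)
      have "k < p"
        using lab_exc_letters(1)[OF s p(1) k(2)] p(2) out sc by (meson leI)
      \<comment> \<open>The threshold \<open>exc_level r m s + r\<close> is
        \<open>above m k s + k + 1 - cross s k\<close>. As \<open>cross s k \<le> k\<close>, it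
        separates the labels up to \<open>above m k s\<close> from those beyond
        \<open>above m k s + k\<close>.\<close>
      moreover have "p \<notin> insert (Suc m) (exc_letters m s) \<longleftrightarrow> exc_level r m s + r \<le> c"
        using lab_exc_letters(2,3)[OF s p(1) k(2) \<open>k < p\<close>] p(2) cross_le sc k unfolding above_def by fastforce
      ultimately show ?thesis
        unfolding ins sc using exc_level_han[OF s p(1), of r] k by simp
    qed
  qed
qed

text \<open>The recursion sees a permutation only through its two statistics, so a bijection for
  \<open>m\<close> extends to \<open>Suc m\<close>: undo \<open>F\<close>, apply it with the label
  kept, then apply \<open>G\<close>.\<close>

lemma ex_bij_stats:
  fixes st1 st2 st1' st2' :: "nat \<Rightarrow> (nat \<Rightarrow> nat) \<Rightarrow> nat"
  assumes F: "\<And>m. bij_betw (F m) (perms m \<times> {0..m}) (perms (Suc m))"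
      "\<And>m s c. s \<in> perms m \<Longrightarrow> c \<in> {0..m} \<Longrightarrow> st1 (Suc m) (F m (s, c)) = st1 m s + of_bool (st1 m s + r \<le> c)"
      "\<And>m s c. s \<in> perms m \<Longrightarrow> c \<in> {0..m} \<Longrightarrow> st2 (Suc m) (F m (s, c)) = st2 m s + c"
    and G: "\<And>m. bij_betw (G m) (perms m \<times> {0..m}) (perms (Suc m))"
      "\<And>m s c. s \<in> perms m \<Longrightarrow> c \<in> {0..m} \<Longrightarrow> st1' (Suc m) (G m (s, c)) = st1' m s + of_bool (st1' m s + r \<le> c)"
      "\<And>m s c. s \<in> perms m \<Longrightarrow> c \<in> {0..m} \<Longrightarrow> st2' (Suc m) (G m (s, c)) = st2' m s + c"
    and base: "\<And>s. s \<in> perms 0 \<Longrightarrow> st1 0 s = st1' 0 s \<and> st2 0 s = st2' 0 s"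
  shows "\<exists>\<phi>. bij_betw \<phi> (perms n) (perms n) \<and> (\<forall>s\<in>perms n. st1' n (\<phi> s) = st1 n s \<and> st2' n (\<phi> s) = st2 n s)"
proof (induction n)
  case 0
  show ?case by (rule exI[of _ id]) (use base in \<open>simp add: bij_betw_def\<close>)
next
  case (Suc m)
  then obtain \<phi> where \<phi>: "bij_betw \<phi> (perms m) (perms m)"
    "\<And>s. s \<in> perms m \<Longrightarrow> st1' m (\<phi> s) = st1 m s \<and> st2' m (\<phi> s) = st2 m s" by blast
  let ?A = "perms m \<times> {0..m}"
  let ?\<psi> = "G m \<circ> map_prod \<phi> id \<circ> the_inv_into ?A (F m)"
  have inv: "bij_betw (the_inv_into ?A (F m)) (perms (Suc m)) ?A"
    by (rule bij_betw_the_inv_into[OF F(1)])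
  have "bij_betw (map_prod \<phi> id) ?A ?A"
    by (rule bij_betw_map_prod[OF \<phi>(1)]) simp
  then have "bij_betw ?\<psi> (perms (Suc m)) (perms (Suc m))"
    using inv G(1) by (intro bij_betw_trans) auto
  moreover have "st1' (Suc m) (?\<psi> t) = st1 (Suc m) t \<and> st2' (Suc m) (?\<psi> t) = st2 (Suc m) t"
    if t: "t \<in> perms (Suc m)" for t
  proof -
    obtain s c where sc: "the_inv_into ?A (F m) t = (s, c)" by (meson surj_pair)
    have mem: "s \<in> perms m" "c \<in> {0..m}" using bij_betwE[OF inv] t sc by (metis mem_Sigma_iff)+
    have t': "t = F m (s, c)" using f_the_inv_into_f_bij_betw[OF F(1) t] sc by simp
    have "\<phi> s \<in> perms m" using bij_betwE[OF \<phi>(1)] mem(1) by blast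
    then have "st1' (Suc m) (G m (\<phi> s, c)) = st1 (Suc m) t" "st2' (Suc m) (G m (\<phi> s, c)) = st2 (Suc m) t"
      using F(2,3)[OF mem] G(2,3)[OF _ mem(2)] \<phi>(2)[OF mem(1)] by (auto simp: t')
    then show ?thesis by (simp add: sc)
  qed
  ultimately show ?case by blast
qed

theorem theorem1p3:
  fixes r :: nat and t q :: "'a::comm_semiring_1"
  assumes "r \<ge> 1"
  shows "r_Euler_Mahonian r (exc_level r) den \<and>
    (\<forall>n\<ge>1. (\<Sum>\<sigma>\<in>perms n. t ^ exc_level r n \<sigma> * q ^ den n \<sigma>)
           = (\<Sum>\<sigma>\<in>perms n. t ^ rdes r n \<sigma> * q ^ rmaj r n \<sigma>))"
proof -
  have base: "exc_level r 0 s = rdes r 0 s \<and> den 0 s = rmaj r 0 s" for s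
    by (simp add: exc_level_def rdes_def rDes_def den_eq_sums rmaj_def)
  have ex: "\<exists>\<phi>. bij_betw \<phi> (perms n) (perms n) \<and> (\<forall>s\<in>perms n. rdes r n (\<phi> s) = exc_level r n s \<and> rmaj r n (\<phi> s) = den n s)" for n
    by (rule ex_bij_stats[where F = "exc_ins r" and G = "des_ins r" and r = r])
      (use exc_ins[OF assms] des_ins[OF assms] base in auto)
  have "card {\<sigma> \<in> perms n. exc_level r n \<sigma> = a \<and> den n \<sigma> = b} = card {\<sigma> \<in> perms n. rdes r n \<sigma> = a \<and> rmaj r n \<sigma> = b}" for n a b
  proof -
    obtain \<phi> where \<phi>: "bij_betw \<phi> (perms n) (perms n)"
      "\<forall>s\<in>perms n. rdes r n (\<phi> s) = exc_level r n s \<and> rmaj r n (\<phi> s) = den n s" using ex by blast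
    have "bij_betw \<phi> {\<sigma> \<in> perms n. exc_level r n \<sigma> = a \<and> den n \<sigma> = b} {\<sigma> \<in> perms n. rdes r n \<sigma> = a \<and> rmaj r n \<sigma> = b}"
      unfolding bij_betw_def
    proof
      show "inj_on \<phi> {\<sigma> \<in> perms n. exc_level r n \<sigma> = a \<and> den n \<sigma> = b}"
        by (rule inj_on_subset[OF bij_betw_imp_inj_on[OF \<phi>(1)]]) auto
      show "\<phi> ` {\<sigma> \<in> perms n. exc_level r n \<sigma> = a \<and> den n \<sigma> = b} = {\<sigma> \<in> perms n. rdes r n \<sigma> = a \<and> rmaj r n \<sigma> = b}"
      proof -
        have "{\<sigma> \<in> perms n. exc_level r n \<sigma> = a \<and> den n \<sigma> = b} = {\<sigma> \<in> perms n. rdes r n (\<phi> \<sigma>) = a \<and> rmaj r n (\<phi> \<sigma>) = b}"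
          using \<phi>(2) by auto
        moreover have "\<phi> ` {\<sigma> \<in> perms n. rdes r n (\<phi> \<sigma>) = a \<and> rmaj r n (\<phi> \<sigma>) = b} = {\<sigma> \<in> \<phi> ` perms n. rdes r n \<sigma> = a \<and> rmaj r n \<sigma> = b}" by blast
        ultimately show ?thesis unfolding bij_betw_imp_surj_on[OF \<phi>(1)] by simp
      qed
    qed
    then show ?thesis by (rule bij_betw_same_card)
  qed
  moreover have "(\<Sum>\<sigma>\<in>perms n. t ^ exc_level r n \<sigma> * q ^ den n \<sigma>) = (\<Sum>\<sigma>\<in>perms n. t ^ rdes r n \<sigma> * q ^ rmaj r n \<sigma>)" for n
  proof -
    obtain \<phi> where \<phi>: "bij_betw \<phi> (perms n) (perms n)"
      "\<forall>s\<in>perms n. rdes r n (\<phi> s) = exc_level r n s \<and> rmaj r n (\<phi> s) = den n s" using ex by blast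
    show ?thesis
      unfolding sum.reindex_bij_betw[OF \<phi>(1), of "\<lambda>\<sigma>. t ^ rdes r n \<sigma> * q ^ rmaj r n \<sigma>", symmetric]
      by (rule sum.cong) (use \<phi>(2) in auto)
  qed
  ultimately show ?thesis unfolding r_Euler_Mahonian_def by blast
qed

end
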